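(* Ordering real quadratic fields $K$ by discriminant, one has $$|w(\Lambda_K)|\le \frac{4R_K}{\sqrt3}+O\!\left(\Delta_K^{1/4}\right)\quad\text{as }\Delta_K\to\infty.$$
   Context: $K=\mathbb{Q}(\sqrt D)\subset\mathbb{R}$, $D>1$ square-free, with discriminant $\Delta_K$ and regulator $R_K$. $\Lambda_K=\{(x,\bar x):x\in\mathcal{O}_K\}\subset\mathbb{R}^2$, where $\bar x$ is the Galois conjugate. For $\alpha>0$, $T_\alpha=\mathrm{diag}(\alpha,1/\alpha)$. Two planar lattices are similar if one is obtained from the other by a rotation and positive scaling; a lattice is well-rounded if its minimal nonzero vectors span $\mathbb{R}^2$. $w(\Lambda_K)$ is the set of similarity classes of well-rounded lattices of the form $T_\alpha\Lambda_K$, $\alpha>0$. *)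

theory Defs
  imports
    "HOL-Analysis.Analysis"
    "HOL-Computational_Algebra.Computational_Algebra"
    "HOL-Library.Landau_Symbols"
begin

section \<open>Real quadratic fields\<close>

text \<open>
  The field \<open>\<rat>(\<surd>D)\<close> is viewed inside the reals. The parameter \<open>D\<close> is intended to be a
  squarefree integer greater than 1; distinct such \<open>D\<close> give distinct fields.
\<close>

definition quad_field :: "nat \<Rightarrow> real set" where
  "quad_field D = {a + b * sqrt (real D) | a b. a \<in> \<rat> \<and> b \<in> \<rat>}"

text \<open>A junk value results outside \<^term>\<open>quad_field D\<close>, see \<open>gal_conj_eq\<close> below.\<close>

definition gal_conj :: "nat \<Rightarrow> real \<Rightarrow> real" where
  "gal_conj D x =
     (THE y. \<exists>a\<in>\<rat>. \<exists>b\<in>\<rat>. x = a + b * sqrt (real D) \<and> y = a - b * sqrt (real D))"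

definition ring_of_ints :: "nat \<Rightarrow> real set" where
  "ring_of_ints D = {x \<in> quad_field D. algebraic_int x}"

definition integral_basis :: "nat \<Rightarrow> real \<Rightarrow> real \<Rightarrow> bool" where
  "integral_basis D u v \<longleftrightarrow>
     u \<in> ring_of_ints D \<and> v \<in> ring_of_ints D \<and>
     (\<forall>x\<in>ring_of_ints D. \<exists>!p :: int \<times> int. x = of_int (fst p) * u + of_int (snd p) * v)"

definition quad_disc :: "nat \<Rightarrow> real" where
  "quad_disc D =
     (THE d. \<exists>u v. integral_basis D u v \<and>
        d = (det (vector [vector [u, gal_conj D u], vector [v, gal_conj D v]] :: real^2^2))\<^sup>2)"

definition ring_units :: "nat \<Rightarrow> real set" where
  "ring_units D = {u \<in> ring_of_ints D. \<exists>v\<in>ring_of_ints D. u * v = 1}"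

definition is_fundamental_unit :: "nat \<Rightarrow> real \<Rightarrow> bool" where
  "is_fundamental_unit D e \<longleftrightarrow>
     e > 1 \<and> e \<in> ring_units D \<and>
     (\<forall>u\<in>ring_units D. \<exists>n :: int. u = e powi n \<or> u = - (e powi n))"

definition regulator :: "nat \<Rightarrow> real" where
  "regulator D = ln (THE e. is_fundamental_unit D e)"

definition quad_fields_by_disc :: "nat filter" where
  "quad_fields_by_disc =
     inf (filtercomap quad_disc at_top) (principal {D. D > 1 \<and> squarefree D})"


section \<open>Planar lattices\<close>

definition similar :: "(real^2) set \<Rightarrow> (real^2) set \<Rightarrow> bool" where
  "similar L M \<longleftrightarrow>
     (\<exists>(Q :: real^2^2) c. rotation_matrix Q \<and> c > 0 \<and> M = (\<lambda>v. c *\<^sub>R (Q *v v)) ` L)"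

definition minimal_vectors :: "(real^2) set \<Rightarrow> (real^2) set" where
  "minimal_vectors L = {v \<in> L. v \<noteq> 0 \<and> (\<forall>u\<in>L. u \<noteq> 0 \<longrightarrow> norm v \<le> norm u)}"

definition well_rounded :: "(real^2) set \<Rightarrow> bool" where
  "well_rounded L \<longleftrightarrow> span (minimal_vectors L) = UNIV"


section \<open>Well-rounded twists\<close>

definition quad_lattice :: "nat \<Rightarrow> (real^2) set" where
  "quad_lattice D = {vector [x, gal_conj D x] | x. x \<in> ring_of_ints D}"

definition twist :: "real \<Rightarrow> real^2^2" where
  "twist \<alpha> = vector [vector [\<alpha>, 0], vector [0, 1 / \<alpha>]]"

definition wr_twists :: "nat \<Rightarrow> (real^2) set set" where
  "wr_twists D =
     {L. \<exists>\<alpha>>0. L = (\<lambda>v. twist \<alpha> *v v) ` quad_lattice D \<and> well_rounded L}"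

text \<open>A similarity class consists of all sets similar to a given one; see \<open>equiv_similar\<close>.\<close>

definition wr_classes :: "nat \<Rightarrow> (real^2) set set set" where
  "wr_classes D = wr_twists D // {(L, M). similar L M}"


section \<open>Well-definedness\<close>

lemma irrational_sqrt_squarefree:
  assumes "D > 1" "squarefree D"
  shows "sqrt (real D) \<notin> \<rat>"
proof
  assume "sqrt (real D) \<in> \<rat>"
  then obtain m n :: nat where n: "n \<noteq> 0" and mn: "\<bar>sqrt (real D)\<bar> = real m / real n"
    and cop: "coprime m n"
    by (rule Rats_abs_nat_div_natE)
  have "real D = (real m / real n)\<^sup>2"
    by (metis mn power2_abs real_sqrt_pow2 of_nat_0_le_iff)
  hence "real (D * n\<^sup>2) = real (m\<^sup>2)"
    using n by (simp add: field_simps)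
  hence eq: "D * n\<^sup>2 = m\<^sup>2"
    using of_nat_eq_iff by blast
  hence "n\<^sup>2 dvd m\<^sup>2"
    by (metis dvd_triv_right)
  hence "n = 1"
    using cop by (simp add: coprime_absorb_right)
  hence "m\<^sup>2 dvd D"
    using eq by simp
  hence "m = 1"
    using assms(2) by (auto simp: squarefree_def)
  thus False
    using eq \<open>n = 1\<close> assms(1) by simp
qed

lemma gal_conj_eq:
  assumes D: "D > 1" "squarefree D" and ab: "a \<in> \<rat>" "b \<in> \<rat>"
  shows "gal_conj D (a + b * sqrt (real D)) = a - b * sqrt (real D)"
  unfolding gal_conj_def
proof (rule the_equality)
  show "\<exists>a'\<in>\<rat>. \<exists>b'\<in>\<rat>. a + b * sqrt (real D) = a' + b' * sqrt (real D) \<and>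
          a - b * sqrt (real D) = a' - b' * sqrt (real D)"
    using ab by blast
next
  fix y
  assume "\<exists>a'\<in>\<rat>. \<exists>b'\<in>\<rat>. a + b * sqrt (real D) = a' + b' * sqrt (real D) \<and>
            y = a' - b' * sqrt (real D)"
  then obtain a' b' where r: "a' \<in> \<rat>" "b' \<in> \<rat>"
    and eq: "a + b * sqrt (real D) = a' + b' * sqrt (real D)" "y = a' - b' * sqrt (real D)"
    by blast
  have "b = b'"
  proof (rule ccontr)
    assume "b \<noteq> b'"
    hence "sqrt (real D) = (a' - a) / (b - b')"
      using eq(1) by (simp add: field_simps)
    hence "sqrt (real D) \<in> \<rat>"
      using ab r by simp
    thus False
      using irrational_sqrt_squarefree[OF D] by simp
  qed
  thus "y = a - b * sqrt (real D)"
    using eq by simp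
qed

lemma fundamental_unit_unique:
  assumes "is_fundamental_unit D e" "is_fundamental_unit D f"
  shows "e = f"
proof -
  have aux: "e \<le> f" if ef: "is_fundamental_unit D e" "is_fundamental_unit D f" for e f
  proof -
    have e: "e > 1" and f: "f > 1"
      using ef by (auto simp: is_fundamental_unit_def)
    obtain n :: int where n: "f = e powi n \<or> f = - (e powi n)"
      using ef unfolding is_fundamental_unit_def by blast
    have "e powi n > 0"
      using e by simp
    with n f have fn: "f = e powi n"
      by auto
    have "n \<ge> 1"
    proof (rule ccontr)
      assume "\<not> n \<ge> 1"
      hence "e powi n \<le> e powi 0"
        using e by (intro power_int_increasing) auto
      thus False
        using fn f by simp
    qed
    hence "e powi 1 \<le> e powi n"
      using e by (intro power_int_increasing) auto
    thus ?thesis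
      using fn by simp
  qed
  show ?thesis
    using aux[OF assms] aux[OF assms(2,1)] by simp
qed

lemma rotation_matrix_transpose:
  "rotation_matrix Q \<Longrightarrow> rotation_matrix (transpose Q)"
  by (simp add: rotation_matrix_def orthogonal_matrix_transpose)

lemma equiv_similar: "equiv UNIV {(L, M). similar L M}"
proof (rule equivI)
  show "{(L, M). similar L M} \<subseteq> UNIV \<times> UNIV"
    by simp
  show "refl {(L, M). similar L M}"
  proof (rule refl_onI)
    fix L :: "(real^2) set"
    have "rotation_matrix (mat 1 :: real^2^2)"
      by (simp add: rotation_matrix_def orthogonal_matrix_id)
    moreover have "L = (\<lambda>v. 1 *\<^sub>R ((mat 1 :: real^2^2) *v v)) ` L"
      by simp
    ultimately have "similar L L"
      unfolding similar_def using zero_less_one by blast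
    thus "(L, L) \<in> {(L, M). similar L M}"
      by simp
  qed
  show "sym {(L, M). similar L M}"
  proof (rule symI, clarify)
    fix L M :: "(real^2) set"
    assume "similar L M"
    then obtain Q :: "real^2^2" and c where Q: "rotation_matrix Q" and c: "c > 0"
      and M: "M = (\<lambda>v. c *\<^sub>R (Q *v v)) ` L"
      unfolding similar_def by blast
    have "transpose Q ** Q = mat 1"
      using Q by (simp add: rotation_matrix_def orthogonal_matrix)
    hence inv: "transpose Q *v (Q *v v) = v" for v
      by (simp add: matrix_vector_mul_assoc)
    have "(1 / c) *\<^sub>R (transpose Q *v (c *\<^sub>R (Q *v v))) = v" for v
      using c inv by (simp add: matrix_vector_mult_scaleR)
    hence "L = (\<lambda>v. (1 / c) *\<^sub>R (transpose Q *v v)) ` M"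
      unfolding M image_image by simp
    moreover have "1 / c > 0"
      using c by simp
    ultimately show "similar M L"
      unfolding similar_def using rotation_matrix_transpose[OF Q] by blast
  qed
  show "trans {(L, M). similar L M}"
  proof (rule transI, clarify)
    fix L M N :: "(real^2) set"
    assume "similar L M" "similar M N"
    then obtain Q P :: "real^2^2" and c d where Q: "rotation_matrix Q" "c > 0"
      and P: "rotation_matrix P" "d > 0"
      and MN: "M = (\<lambda>v. c *\<^sub>R (Q *v v)) ` L" "N = (\<lambda>v. d *\<^sub>R (P *v v)) ` M"
      unfolding similar_def by blast
    have "rotation_matrix (P ** Q)"
      using P Q by (simp add: rotation_matrix_def orthogonal_matrix_mul det_mul)
    moreover have "N = (\<lambda>v. (d * c) *\<^sub>R ((P ** Q) *v v)) ` L"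
      unfolding MN image_image
      by (simp add: matrix_vector_mult_scaleR flip: matrix_vector_mul_assoc)
    moreover have "d * c > 0"
      using P Q by simp
    ultimately show "similar L N"
      unfolding similar_def by blast
  qed
qed

end

theory Submission
  imports Defs "HOL-Analysis.Kronecker_Approximation_Theorem"
begin

text \<open>
  If \<open>T\<^sub>\<alpha>\<Lambda>\<close> is well-rounded, it has two minimal vectors with different first coordinates. Sending
  \<open>\<alpha>\<close> to the smaller first coordinate \<open>v\<close> is strictly decreasing. Every such \<open>v\<close> is a minimum in
  the sense of Voronoi: no nonzero \<open>y\<close> has \<open>\<bar>y\<bar> < v\<close> and \<open>\<bar>\<sigma> y\<bar> \<le> \<bar>\<sigma> v\<bar>\<close>. Minima grow at least like
  the Fibonacci numbers (\<open>x > y > z\<close> implies \<open>x \<ge> y + z\<close>). Units and Galois conjugation move every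
  well-rounded twist into a window \<open>[\<beta>, e\<beta>]\<close>, with \<open>e\<close> the fundamental unit, and there the values
  of \<open>v\<close> differ by a factor of at most \<open>e\<close>. So there are at most \<open>R\<^sub>K / ln c + O(1)\<close> classes for
  every \<open>c \<ge> 1\<close> with \<open>c\<^sup>2 \<le> c + 1\<close>, and such a \<open>c\<close> with \<open>ln c \<ge> sqrt 3 / 4\<close> exists. The error
  term is thus bounded by a constant.
\<close>

section \<open>Integers of a real quadratic field\<close>

text \<open>All powers of the reduced denominator \<open>q\<close> of \<open>r\<close> divide the
  fixed number \<open>d\<close>, which forces \<open>q = 1\<close>.\<close>

lemma rat_bounded_denominators_imp_int:
  fixes r :: real and d :: int
  assumes "r \<in> \<rat>" "d \<noteq> 0" and "\<And>k. of_int d * r ^ k \<in> \<int>"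
  shows "r \<in> \<int>"
proof -
  obtain p q :: int where q: "q > 0" and cop: "coprime p q" and r: "r = of_int p / of_int q"
    using \<open>r \<in> \<rat>\<close> by (auto elim: Rats_cases')
  have dvd: "q ^ k dvd d" for k
  proof -
    obtain z where "of_int d * r ^ k = (of_int z :: real)"
      using assms(3) by (auto elim: Ints_cases)
    hence "of_int (d * p ^ k) = (of_int (z * q ^ k) :: real)"
      using q by (simp add: r field_simps)
    hence "d * p ^ k = z * q ^ k"
      by (simp only: of_int_eq_iff)
    hence "q ^ k dvd d * p ^ k"
      by simp
    moreover have "coprime (q ^ k) (p ^ k)"
      using cop by (simp add: coprime_commute)
    ultimately show ?thesis
      by (simp add: coprime_dvd_mult_left_iff)
  qed
  have "q = 1"
  proof (rule ccontr)
    assume "q \<noteq> 1"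
    hence "q \<ge> 2"
      using q by simp
    define k where "k = nat \<bar>d\<bar>"
    have "\<bar>d\<bar> < 2 ^ k"
      unfolding k_def by (metis abs_ge_zero int_nat_eq of_nat_less_two_power)
    also have "\<dots> \<le> q ^ k"
      using \<open>q \<ge> 2\<close> by (intro power_mono) auto
    also have "\<dots> \<le> \<bar>d\<bar>"
      using dvd_imp_le_int[OF \<open>d \<noteq> 0\<close> dvd[of k]] q by simp
    finally show False
      by simp
  qed
  thus ?thesis
    by (simp add: r)
qed

locale real_quadratic =
  fixes D :: nat
  assumes D_gt_1: "D > 1" and squarefree_D: "squarefree D"
begin

abbreviation s :: real where "s \<equiv> sqrt (real D)"
abbreviation K :: "real set" where "K \<equiv> quad_field D"
abbreviation OK :: "real set" ("\<O>") where "\<O> \<equiv> ring_of_ints D"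
abbreviation galois :: "real \<Rightarrow> real" ("\<sigma>") where "\<sigma> \<equiv> gal_conj D"

lemma s_irrational: "s \<notin> \<rat>"
  using irrational_sqrt_squarefree[OF D_gt_1 squarefree_D] .

lemma s_mult_s [simp]: "s * s = real D"
  by simp

section \<open>Arithmetic and Galois conjugation in \<open>K\<close>\<close>

lemmas conj_eq = gal_conj_eq[OF D_gt_1 squarefree_D]

lemma K_I: "a \<in> \<rat> \<Longrightarrow> b \<in> \<rat> \<Longrightarrow> a + b * s \<in> K"
  unfolding quad_field_def by blast

lemma K_E:
  assumes "x \<in> K"
  obtains a b where "a \<in> \<rat>" "b \<in> \<rat>" "x = a + b * s" "\<sigma> x = a - b * s"
  using assms conj_eq unfolding quad_field_def by blast

lemma K_rat: "a \<in> \<rat> \<Longrightarrow> a \<in> K" and conj_rat: "a \<in> \<rat> \<Longrightarrow> \<sigma> a = a"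
  using K_I[of a 0] conj_eq[of a 0] by auto

lemma K_add [intro]: "x \<in> K \<Longrightarrow> y \<in> K \<Longrightarrow> x + y \<in> K"
  and conj_add: "x \<in> K \<Longrightarrow> y \<in> K \<Longrightarrow> \<sigma> (x + y) = \<sigma> x + \<sigma> y"
proof -
  assume "x \<in> K" "y \<in> K"
  then obtain a b c d where x: "a \<in> \<rat>" "b \<in> \<rat>" "x = a + b * s" "\<sigma> x = a - b * s"
    and y: "c \<in> \<rat>" "d \<in> \<rat>" "y = c + d * s" "\<sigma> y = c - d * s"
    by (metis K_E)
  have eq: "x + y = (a + c) + (b + d) * s"
    by (simp add: x y algebra_simps)
  show "x + y \<in> K"
    unfolding eq using x y by (intro K_I) auto
  show "\<sigma> (x + y) = \<sigma> x + \<sigma> y"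
    unfolding eq using x y by (subst conj_eq) (auto simp: algebra_simps)
qed

lemma K_mult [intro]: "x \<in> K \<Longrightarrow> y \<in> K \<Longrightarrow> x * y \<in> K"
  and conj_mult: "x \<in> K \<Longrightarrow> y \<in> K \<Longrightarrow> \<sigma> (x * y) = \<sigma> x * \<sigma> y"
proof -
  assume "x \<in> K" "y \<in> K"
  then obtain a b c d where x: "a \<in> \<rat>" "b \<in> \<rat>" "x = a + b * s" "\<sigma> x = a - b * s"
    and y: "c \<in> \<rat>" "d \<in> \<rat>" "y = c + d * s" "\<sigma> y = c - d * s"
    by (metis K_E)
  have eq: "x * y = (a * c + b * d * (s * s)) + (a * d + b * c) * s"
    unfolding x y by (simp only: algebra_simps)
  show "x * y \<in> K"
    unfolding eq s_mult_s using x y by (intro K_I) auto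
  have "\<sigma> (x * y) = (a * c + b * d * (s * s)) - (a * d + b * c) * s"
    unfolding eq s_mult_s using x y by (intro conj_eq) auto
  also have "\<dots> = \<sigma> x * \<sigma> y"
    unfolding x(4) y(4) by (simp only: algebra_simps)
  finally show "\<sigma> (x * y) = \<sigma> x * \<sigma> y" .
qed

lemma K_conj: "x \<in> K \<Longrightarrow> \<sigma> x \<in> K" and conj_conj: "x \<in> K \<Longrightarrow> \<sigma> (\<sigma> x) = x"
proof -
  assume "x \<in> K"
  then obtain a b where x: "a \<in> \<rat>" "b \<in> \<rat>" "x = a + b * s" "\<sigma> x = a + (- b) * s"
    by (metis K_E diff_minus_eq_add minus_mult_left add.inverse_inverse)
  show "\<sigma> x \<in> K"
    unfolding x(4) using x by (intro K_I) auto
  show "\<sigma> (\<sigma> x) = x"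
    unfolding x(4) using x by (subst conj_eq) auto
qed

lemma K_minus: "x \<in> K \<Longrightarrow> - x \<in> K" and conj_minus: "x \<in> K \<Longrightarrow> \<sigma> (- x) = - \<sigma> x"
  using K_mult[of "-1" x] conj_mult[of "-1" x] K_rat[of "-1"] conj_rat[of "-1"] by auto

lemma conj_diff: "x \<in> K \<Longrightarrow> y \<in> K \<Longrightarrow> \<sigma> (x - y) = \<sigma> x - \<sigma> y"
  using conj_add[of x "- y"] K_minus conj_minus by auto

lemma K_power: "x \<in> K \<Longrightarrow> x ^ n \<in> K"
  and conj_power: "x \<in> K \<Longrightarrow> \<sigma> (x ^ n) = \<sigma> x ^ n"
proof -
  assume x: "x \<in> K"
  have *: "x ^ n \<in> K \<and> \<sigma> (x ^ n) = \<sigma> x ^ n"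
    by (induction n) (use x K_rat[of 1] conj_rat[of 1] in \<open>auto simp: conj_mult\<close>)
  show "x ^ n \<in> K" "\<sigma> (x ^ n) = \<sigma> x ^ n"
    using * by auto
qed

lemma conj_eq_0_iff: "x \<in> K \<Longrightarrow> \<sigma> x = 0 \<longleftrightarrow> x = 0"
  using conj_conj[of x] conj_rat[of 0] by auto

lemma trace_rat: "x \<in> K \<Longrightarrow> x + \<sigma> x \<in> \<rat>"
  by (auto elim!: K_E)

lemma norm_rat: "x \<in> K \<Longrightarrow> x * \<sigma> x \<in> \<rat>"
proof -
  assume "x \<in> K"
  then obtain a b where x: "a \<in> \<rat>" "b \<in> \<rat>" "x = a + b * s" "\<sigma> x = a - b * s"
    by (rule K_E)
  have "x * \<sigma> x = (a + b * s) * (a - b * s)"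
    by (simp only: x(4)) (simp only: x(3))
  also have "\<dots> = a * a - b * b * (s * s)"
    by (simp only: algebra_simps)
  finally show ?thesis
    using x by simp
qed

text \<open>The order generated by \<open>s\<close>. It can be smaller than \<open>\<O>\<close>, but
  its elements have integer coordinates, so denominators can be cleared and congruences stated in
  it.\<close>

definition Zs :: "real set" where
  "Zs = {of_int a + of_int b * s | a b. True}"

lemma Zs_I: "of_int a + of_int b * s \<in> Zs"
  unfolding Zs_def by blast

lemma Zs_E:
  assumes "x \<in> Zs"
  obtains a b where "x = of_int a + of_int b * s" "\<sigma> x = of_int a - of_int b * s"
  using assms conj_eq unfolding Zs_def by auto

lemma Zs_K: "x \<in> Zs \<Longrightarrow> x \<in> K"
  unfolding Zs_def using K_I by auto

lemma Zs_of_int [simp, intro]: "of_int a \<in> Zs"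
  using Zs_I[of a 0] by simp

lemma Zs_add [intro]: "x \<in> Zs \<Longrightarrow> y \<in> Zs \<Longrightarrow> x + y \<in> Zs"
proof -
  assume "x \<in> Zs" "y \<in> Zs"
  then obtain a b c d where "x = of_int a + of_int b * s" "y = of_int c + of_int d * s"
    by (metis Zs_E)
  hence "x + y = of_int (a + c) + of_int (b + d) * s"
    by (simp add: algebra_simps)
  thus ?thesis
    using Zs_I by metis
qed

lemma Zs_mult [intro]: "x \<in> Zs \<Longrightarrow> y \<in> Zs \<Longrightarrow> x * y \<in> Zs"
proof -
  assume "x \<in> Zs" "y \<in> Zs"
  then obtain a b c d where x: "x = of_int a + of_int b * s" and y: "y = of_int c + of_int d * s"
    by (metis Zs_E)
  have "x * y = (of_int a * of_int c + of_int b * of_int d * (s * s)) + (of_int a * of_int d + of_int b * of_int c) * s"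
    unfolding x y by (simp only: algebra_simps)
  also have "\<dots> = of_int (a * c + b * d * int D) + of_int (a * d + b * c) * s"
    by simp
  finally show ?thesis
    using Zs_I by metis
qed

lemma Zs_minus: "x \<in> Zs \<Longrightarrow> - x \<in> Zs"
  using Zs_mult[OF Zs_of_int[of "-1"], of x] by simp

lemma Zs_power: "x \<in> Zs \<Longrightarrow> x ^ n \<in> Zs"
  using Zs_of_int[of 1] by (induction n) auto

lemma Zs_sum: "(\<And>i. i \<in> A \<Longrightarrow> f i \<in> Zs) \<Longrightarrow> sum f A \<in> Zs"
  using Zs_of_int[of 0] by (induction A rule: infinite_finite_induct) auto

lemma Zs_conj: "x \<in> Zs \<Longrightarrow> \<sigma> x \<in> Zs"
proof -
  assume "x \<in> Zs"
  then obtain a b where "\<sigma> x = of_int a + of_int (- b) * s"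
    by (auto elim: Zs_E)
  thus ?thesis
    using Zs_I by metis
qed

lemma Zs_rat_imp_int: "x \<in> Zs \<Longrightarrow> x \<in> \<rat> \<Longrightarrow> x \<in> \<int>"
proof -
  assume "x \<in> Zs" and r: "x \<in> \<rat>"
  then obtain a b where x: "x = of_int a + of_int b * s"
    by (auto elim: Zs_E)
  have "b = 0"
  proof (rule ccontr)
    assume "b \<noteq> 0"
    hence "s = (x - of_int a) / of_int b"
      by (simp add: x)
    thus False
      using r s_irrational by (metis Rats_diff Rats_divide Rats_of_int)
  qed
  thus ?thesis
    by (simp add: x)
qed

text \<open>
  This stands in for finite generation of \<open>\<int>[x]\<close>; it is evidently stable under sums, products and
  conjugation, and so yields the ring structure of \<open>\<O>\<close>.
\<close>

definition bdd_den :: "real \<Rightarrow> bool" where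
  "bdd_den x \<longleftrightarrow> (\<exists>d::int. d \<noteq> 0 \<and> (\<forall>k. of_int d * x ^ k \<in> Zs))"

lemma clear_denominator:
  assumes "x \<in> K"
  obtains e :: int where "e \<noteq> 0" "of_int e * x \<in> Zs"
proof -
  obtain a b where x: "a \<in> \<rat>" "b \<in> \<rat>" "x = a + b * s"
    using assms by (rule K_E)
  obtain p q p' q' :: int where "q > 0" "a = of_int p / of_int q" "q' > 0" "b = of_int p' / of_int q'"
    using x by (metis Rats_cases')
  hence "of_int (q * q') * x = of_int (p * q') + of_int (p' * q) * s" "q * q' \<noteq> 0"
    by (auto simp: x field_simps)
  thus ?thesis
    using that Zs_I by metis
qed

text \<open>The monic equation of degree \<open>n\<close> expresses every power \<open>x ^ k\<close>
  with \<open>k \<ge> n\<close> through lower ones with integer coefficients. So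
  \<open>e ^ n\<close>, which clears the powers below \<open>n\<close>, clears all of them.\<close>

lemma algebraic_int_imp_bdd_den:
  assumes "x \<in> K" "algebraic_int x"
  shows "bdd_den x"
proof -
  obtain p where p: "lead_coeff p = 1" "\<And>i. coeff p i \<in> \<int>" "poly p x = 0"
    using assms(2) by (auto elim: algebraic_int.cases)
  define n where "n = degree p"
  have "0 = (\<Sum>i\<le>n. coeff p i * x ^ i)"
    using p by (simp add: poly_altdef n_def)
  also have "\<dots> = (\<Sum>i<n. coeff p i * x ^ i) + x ^ n"
    using p by (simp add: n_def flip: lessThan_Suc_atMost)
  finally have xn: "x ^ n = - (\<Sum>i<n. coeff p i * x ^ i)"
    by linarith
  obtain e :: int where e: "e \<noteq> 0" "of_int e * x \<in> Zs"
    using clear_denominator[OF assms(1)] .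
  have "of_int (e ^ n) * x ^ k \<in> Zs" for k
  proof (induction k rule: less_induct)
    case (less k)
    show ?case
    proof (cases "k < n")
      case True
      have "of_int (e ^ n) * x ^ k = of_int (e ^ (n - k)) * (of_int e * x) ^ k"
        using True by (simp add: power_mult_distrib flip: power_add)
      thus ?thesis
        using e Zs_power by (metis Zs_mult Zs_of_int)
    next
      case False
      have "x ^ k = x ^ (k - n) * x ^ n"
        using False by (simp flip: power_add)
      also have "\<dots> = - (\<Sum>i<n. coeff p i * x ^ (k - n + i))"
        unfolding xn by (simp add: sum_distrib_left power_add mult_ac)
      finally have "of_int (e ^ n) * x ^ k =
          - (\<Sum>i<n. coeff p i * (of_int (e ^ n) * x ^ (k - n + i)))"
        by (simp add: sum_distrib_left mult_ac)
      also have "\<dots> \<in> Zs"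
      proof (intro Zs_minus Zs_sum)
        fix i assume "i \<in> {..<n}"
        hence "of_int (e ^ n) * x ^ (k - n + i) \<in> Zs"
          using False by (intro less.IH) auto
        thus "coeff p i * (of_int (e ^ n) * x ^ (k - n + i)) \<in> Zs"
          using p(2)[of i] by (metis Ints_cases Zs_mult Zs_of_int)
      qed
      finally show ?thesis .
    qed
  qed
  thus ?thesis
    unfolding bdd_den_def using e(1) by (intro exI[of _ "e ^ n"]) auto
qed

lemma bdd_den_add:
  assumes "bdd_den x" "bdd_den y"
  shows "bdd_den (x + y)"
proof -
  obtain d e :: int where d: "d \<noteq> 0" "\<And>k. of_int d * x ^ k \<in> Zs" and e: "e \<noteq> 0" "\<And>k. of_int e * y ^ k \<in> Zs"
    using assms unfolding bdd_den_def by blast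
  have "of_int (d * e) * (x + y) ^ k \<in> Zs" for k
  proof -
    have "of_int (d * e) * (x + y) ^ k =
        (\<Sum>i\<le>k. of_int (int (k choose i)) * ((of_int d * x ^ i) * (of_int e * y ^ (k - i))))"
      by (simp add: binomial_ring sum_distrib_left mult_ac)
    also have "\<dots> \<in> Zs"
      by (intro Zs_sum Zs_mult[OF Zs_of_int] Zs_mult[OF d(2) e(2)])
    finally show ?thesis .
  qed
  thus ?thesis
    unfolding bdd_den_def using d(1) e(1) by (intro exI[of _ "d * e"]) auto
qed

lemma bdd_den_mult:
  assumes "bdd_den x" "bdd_den y"
  shows "bdd_den (x * y)"
proof -
  obtain d e :: int where d: "d \<noteq> 0" "\<And>k. of_int d * x ^ k \<in> Zs" and e: "e \<noteq> 0" "\<And>k. of_int e * y ^ k \<in> Zs"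
    using assms unfolding bdd_den_def by blast
  have "of_int (d * e) * (x * y) ^ k \<in> Zs" for k
  proof -
    have "of_int (d * e) * (x * y) ^ k = (of_int d * x ^ k) * (of_int e * y ^ k)"
      by (simp add: power_mult_distrib mult_ac)
    thus ?thesis
      using d e by (metis Zs_mult)
  qed
  thus ?thesis
    unfolding bdd_den_def using d(1) e(1) by (intro exI[of _ "d * e"]) auto
qed

lemma bdd_den_conj:
  assumes "x \<in> K" "bdd_den x"
  shows "bdd_den (\<sigma> x)"
proof -
  obtain d :: int where d: "d \<noteq> 0" "\<And>k. of_int d * x ^ k \<in> Zs"
    using assms unfolding bdd_den_def by blast
  have "of_int d * \<sigma> x ^ k \<in> Zs" for k
  proof -
    have "\<sigma> (of_int d * x ^ k) = of_int d * \<sigma> x ^ k"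
      using assms(1) by (simp add: conj_mult conj_power conj_rat K_power K_rat)
    thus ?thesis
      using Zs_conj[OF d(2)[of k]] by simp
  qed
  thus ?thesis
    unfolding bdd_den_def using d(1) by blast
qed

lemma bdd_den_rat:
  assumes "x \<in> \<rat>" "bdd_den x"
  shows "x \<in> \<int>"
proof -
  obtain d :: int where d: "d \<noteq> 0" "\<And>k. of_int d * x ^ k \<in> Zs"
    using assms unfolding bdd_den_def by blast
  have "of_int d * x ^ k \<in> \<int>" for k
    using assms(1) d(2) by (intro Zs_rat_imp_int) auto
  thus ?thesis
    using assms(1) d(1) by (rule rat_bounded_denominators_imp_int[rotated 2])
qed

lemma trace_norm_int_imp_algebraic_int:
  assumes "x \<in> K" "x + \<sigma> x \<in> \<int>" "x * \<sigma> x \<in> \<int>"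
  shows "algebraic_int x"
proof (rule algebraic_int.intros)
  let ?p = "[: x * \<sigma> x, - (x + \<sigma> x), 1 :]"
  show "lead_coeff ?p = 1"
    by simp
  show "\<forall>i. coeff ?p i \<in> \<int>"
    using assms(3) Ints_minus[OF assms(2)] by (auto simp: coeff_pCons split: nat.splits)
  show "poly ?p x = 0"
    by (simp add: algebra_simps)
qed

text \<open>Boundedness of denominators passes to trace and norm, which are rational and hence
  integers; up to sign they are the coefficients of a monic quadratic with root \<open>x\<close>.
  Closure of \<open>\<O>\<close> under sums, products and conjugation follows from this
  description.\<close>

lemma OK_iff_bdd_den: "x \<in> \<O> \<longleftrightarrow> x \<in> K \<and> bdd_den x"
proof
  assume "x \<in> K \<and> bdd_den x"
  hence x: "x \<in> K" "bdd_den x" "bdd_den (\<sigma> x)"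
    using bdd_den_conj by auto
  have "x + \<sigma> x \<in> \<int>" "x * \<sigma> x \<in> \<int>"
    using x by (auto intro!: bdd_den_rat bdd_den_add bdd_den_mult trace_rat norm_rat)
  thus "x \<in> \<O>"
    using x trace_norm_int_imp_algebraic_int unfolding ring_of_ints_def by blast
qed (auto simp: ring_of_ints_def algebraic_int_imp_bdd_den)

lemma OK_K: "x \<in> \<O> \<Longrightarrow> x \<in> K"
  by (simp add: ring_of_ints_def)

lemma OK_add: "x \<in> \<O> \<Longrightarrow> y \<in> \<O> \<Longrightarrow> x + y \<in> \<O>"
  and OK_mult: "x \<in> \<O> \<Longrightarrow> y \<in> \<O> \<Longrightarrow> x * y \<in> \<O>"
  and OK_conj: "x \<in> \<O> \<Longrightarrow> \<sigma> x \<in> \<O>"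
  by (auto simp: OK_iff_bdd_den bdd_den_add bdd_den_mult bdd_den_conj K_conj)

lemma OK_trace: "x \<in> \<O> \<Longrightarrow> x + \<sigma> x \<in> \<int>"
  and OK_norm: "x \<in> \<O> \<Longrightarrow> x * \<sigma> x \<in> \<int>"
  by (auto simp: OK_iff_bdd_den bdd_den_conj intro!: bdd_den_rat bdd_den_add bdd_den_mult trace_rat norm_rat)

lemma Zs_OK: "x \<in> Zs \<Longrightarrow> x \<in> \<O>"
  unfolding OK_iff_bdd_den bdd_den_def using Zs_K Zs_power by (metis mult_1 of_int_1 zero_neq_one)

lemma OK_of_int: "of_int a \<in> \<O>"
  by (simp add: Zs_OK)

lemma OK_minus: "x \<in> \<O> \<Longrightarrow> - x \<in> \<O>"
  using OK_mult[OF OK_of_int[of "-1"]] by simp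

lemma OK_diff: "x \<in> \<O> \<Longrightarrow> y \<in> \<O> \<Longrightarrow> x - y \<in> \<O>"
  using OK_add[OF _ OK_minus] by simp

lemma norm_ge_1:
  assumes "x \<in> \<O>" "x \<noteq> 0"
  shows "\<bar>x\<bar> * \<bar>\<sigma> x\<bar> \<ge> 1"
proof -
  have "x * \<sigma> x \<noteq> 0"
    using assms conj_eq_0_iff OK_K by auto
  hence "\<bar>x * \<sigma> x\<bar> \<ge> 1"
    using OK_norm[OF assms(1)] Ints_nonzero_abs_ge1 by blast
  thus ?thesis
    by (simp add: abs_mult)
qed

text \<open>Discreteness of the lattice: trace and norm are bounded integers, and each of the
  finitely many pairs belongs to a quadratic with at most two roots.\<close>

lemma finite_box: "finite {x \<in> \<O>. \<bar>x\<bar> \<le> A \<and> \<bar>\<sigma> x\<bar> \<le> B}"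
proof -
  define T where "T = {t::int. \<bar>of_int t :: real\<bar> \<le> A + B}"
  define N where "N = {t::int. \<bar>of_int t :: real\<bar> \<le> A * B}"
  have fin: "finite {t::int. \<bar>of_int t :: real\<bar> \<le> C}" for C
  proof (rule finite_subset)
    show "{t::int. \<bar>of_int t :: real\<bar> \<le> C} \<subseteq> {- \<lceil>C\<rceil>..\<lceil>C\<rceil>}"
      by (auto simp: abs_le_iff) linarith+
  qed simp
  have "{x \<in> \<O>. \<bar>x\<bar> \<le> A \<and> \<bar>\<sigma> x\<bar> \<le> B} \<subseteq>
      (\<Union>t\<in>T. \<Union>n\<in>N. {x. poly [:of_int n, - of_int t, 1:] x = 0})"
  proof clarify
    fix x assume x: "x \<in> \<O>" "\<bar>x\<bar> \<le> A" "\<bar>\<sigma> x\<bar> \<le> B"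
    obtain t n where tn: "x + \<sigma> x = of_int t" "x * \<sigma> x = of_int n"
      using OK_trace[OF x(1)] OK_norm[OF x(1)] by (auto elim!: Ints_cases)
    have "\<bar>x * \<sigma> x\<bar> \<le> A * B"
      unfolding abs_mult using x by (intro mult_mono) auto
    hence "n \<in> N"
      by (simp add: N_def tn)
    moreover have "\<bar>x + \<sigma> x\<bar> \<le> A + B"
      using x by linarith
    hence "t \<in> T"
      by (simp add: T_def tn)
    moreover have "poly [:of_int n, - of_int t, 1:] x = 0"
      by (simp add: algebra_simps flip: tn)
    ultimately show "x \<in> (\<Union>t\<in>T. \<Union>n\<in>N. {x. poly [:of_int n, - of_int t, 1:] x = 0})"
      by blast
  qed
  moreover have "finite (\<Union>t\<in>T. \<Union>n\<in>N. {x::real. poly [:of_int n, - of_int t, 1:] x = 0})"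
    unfolding T_def N_def by (intro finite_UN_I fin poly_roots_finite) auto
  ultimately show ?thesis
    by (rule finite_subset)
qed

end

section \<open>Units\<close>

text \<open>Places \<open>x\<close> in a fundamental interval for multiplication by
  \<open>e\<close>; this reduces positive units to \<open>[1, e)\<close> and twists to a
  window.\<close>

lemma powi_bracket:
  fixes e x :: real
  assumes "e > 1" "x > 0"
  obtains n :: int where "e powi n \<le> x" "x < e powi (n + 1)"
proof -
  define n where "n = \<lfloor>log e x\<rfloor>"
  have "real_of_int n \<le> log e x" "log e x < real_of_int (n + 1)"
    unfolding n_def by linarith+
  hence "e powr real_of_int n \<le> x" "x < e powr real_of_int (n + 1)"
    using assms by (simp_all add: le_log_iff log_less_iff)
  moreover have "e powr real_of_int m = e powi m" for m
    using assms by (simp add: powr_real_of_int')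
  ultimately show ?thesis
    using that[of n] by (simp del: of_int_add)
qed

section \<open>A nontrivial unit from Dirichlet approximation\<close>

context real_quadratic
begin

text \<open>Dirichlet's theorem gives a positive \<open>k \<le> N\<close> with
  \<open>\<bar>k s - h\<bar> < 1 / N\<close>. The conjugate is at most \<open>1 + 2 N s\<close> in
  absolute value, so the bound on the norm does not depend on \<open>\<delta>\<close>.\<close>

lemma exists_small_bounded_norm:
  assumes "\<delta> > 0"
  obtains x where "x \<in> Zs" "0 < x" "x < \<delta>" "\<bar>x * \<sigma> x\<bar> \<le> 1 + 2 * s"
proof -
  obtain N :: nat where N: "N > 0" "1 / real N < \<delta>"
    using assms by (metis nat_approx_posE of_nat_0_less_iff zero_less_Suc)
  obtain h k where k: "0 < k" "k \<le> int N" and less: "\<bar>of_int k * s - of_int h\<bar> < 1 / N"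
    using Dirichlet_approx[OF N(1)] by metis
  define y where "y = of_int (- h) + of_int k * s"
  have y: "y \<in> Zs" "\<sigma> y = of_int (- h) - of_int k * s"
    unfolding y_def by (rule Zs_I, rule conj_eq) auto
  have "y \<noteq> 0"
  proof
    assume "y = 0"
    hence "s = of_int h / of_int k"
      using k by (simp add: y_def field_simps)
    thus False
      using s_irrational by (metis Rats_divide Rats_of_int)
  qed
  have y_less: "\<bar>y\<bar> < 1 / N"
    using less by (simp add: y_def)
  have "\<sigma> y = y - 2 * (of_int k * s)"
    unfolding y(2) by (simp add: y_def)
  moreover have "real_of_int k * s \<le> real N * s"
    using k by (intro mult_right_mono) auto
  moreover have "real_of_int k * s \<ge> 0" "1 / real N \<le> 1"
    using k N by auto
  ultimately have "\<bar>\<sigma> y\<bar> \<le> 1 + 2 * (real N * s)"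
    using y_less by linarith
  hence "\<bar>y\<bar> * \<bar>\<sigma> y\<bar> \<le> (1 / N) * (1 + 2 * (real N * s))"
    using y_less by (intro mult_mono) auto
  also have "\<dots> = 1 / N + 2 * s"
    using N by (simp add: field_simps)
  also have "\<dots> \<le> 1 + 2 * s"
    using N by simp
  finally have nrm: "\<bar>y * \<sigma> y\<bar> \<le> 1 + 2 * s"
    by (simp add: abs_mult)
  show ?thesis
  proof (cases "y > 0")
    case True
    thus ?thesis
      using that[of y] y nrm y_less N by simp
  next
    case False
    have "\<bar>- y * \<sigma> (- y)\<bar> \<le> 1 + 2 * s"
      using nrm conj_minus[OF Zs_K[OF y(1)]] by (simp only: minus_mult_minus)
    thus ?thesis
      using False that[of "- y"] Zs_minus[OF y(1)] y_less N \<open>y \<noteq> 0\<close> by simp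
  qed
qed

lemma infinite_bounded_norm: "infinite {x \<in> Zs. 0 < x \<and> \<bar>x * \<sigma> x\<bar> \<le> 1 + 2 * s}"
  (is "infinite ?X")
proof
  assume fin: "finite ?X"
  obtain x0 where "x0 \<in> ?X"
    using exists_small_bounded_norm[of 1] by auto
  hence "Min ?X \<in> ?X"
    using fin by (intro Min_in) auto
  then obtain x where "x \<in> Zs" "0 < x" "x < Min ?X" "\<bar>x * \<sigma> x\<bar> \<le> 1 + 2 * s"
    using exists_small_bounded_norm[of "Min ?X"] by auto
  thus False
    using Min_le[OF fin, of x] by auto
qed

lemma sqrt_mult_conj:
  fixes a b c d :: real
  shows "(a + b * s) * (c - d * s) = (a * c - real D * (b * d)) + (b * c - a * d) * s"
proof -
  have "(a + b * s) * (c - d * s) = (a * c - (s * s) * (b * d)) + (b * c - a * d) * s"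
    by (simp only: algebra_simps)
  thus ?thesis
    by simp
qed

text \<open>Modulo \<open>n\<close> the product of \<open>x\<close> with the conjugate of
  \<open>y\<close> agrees with the norm of \<open>y\<close>, which is \<open>n\<close>. Hence
  \<open>n\<close> divides both coordinates of that product, and dividing it by \<open>n\<close>
  gives \<open>x / y\<close>.\<close>

lemma quotient_in_Zs:
  fixes a b c d :: int
  assumes x: "x = of_int a + of_int b * s" and y: "y = of_int c + of_int d * s"
    and n: "n = a\<^sup>2 - int D * b\<^sup>2" "n = c\<^sup>2 - int D * d\<^sup>2" "n \<noteq> 0"
    and dvd: "n dvd a - c" "n dvd b - d"
  shows "x / y \<in> Zs"
proof -
  have "a * c - int D * (b * d) = n - a * (a - c) + int D * b * (b - d)"
    unfolding n(1) by (simp add: algebra_simps power2_eq_square)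
  hence "n dvd a * c - int D * (b * d)"
    using dvd by simp
  then obtain e where e: "a * c - int D * (b * d) = n * e"
    by blast
  have "b * c - a * d = a * (b - d) - b * (a - c)"
    by (simp add: algebra_simps)
  hence "n dvd b * c - a * d"
    using dvd by simp
  then obtain f where f: "b * c - a * d = n * f"
    by blast
  define z where "z = of_int c - of_int d * s"
  have rn: "real_of_int n = y * z"
    unfolding n(2) y z_def by (simp add: sqrt_mult_conj power2_eq_square)
  have "x * z = of_int (a * c - int D * (b * d)) + of_int (b * c - a * d) * s"
    unfolding x z_def by (simp add: sqrt_mult_conj)
  also have "\<dots> = (of_int e + of_int f * s) * (y * z)"
    unfolding e f rn[symmetric] by (simp add: distrib_left distrib_right mult_ac)
  finally have "x * z = (of_int e + of_int f * s) * y * z"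
    by simp
  moreover have "z \<noteq> 0" "y \<noteq> 0"
    using rn n(3) by auto
  ultimately have "x / y = of_int e + of_int f * s"
    by (simp add: nonzero_divide_eq_eq)
  thus ?thesis
    using Zs_I by metis
qed

lemma Zs_units: "x \<in> Zs \<Longrightarrow> y \<in> Zs \<Longrightarrow> x * y = 1 \<Longrightarrow> x \<in> ring_units D"
  unfolding ring_units_def using Zs_OK by blast

text \<open>Pigeonhole: infinitely many elements of bounded norm share finitely many triples of norm
  and residues modulo the norm. Two elements with the same triple have both quotients in
  \<open>Zs\<close>, and one of these exceeds 1.\<close>

lemma exists_unit_gt_1: obtains u where "u \<in> ring_units D" "u > 1"
proof -
  define r where "r = (\<lambda>(a::int, b::int). of_int a + of_int b * s)"
  define P where "P = {p. 0 < r p \<and> \<bar>r p * \<sigma> (r p)\<bar> \<le> 1 + 2 * s}"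
  define nm where "nm = (\<lambda>(a::int, b::int). a\<^sup>2 - int D * b\<^sup>2)"
  define f where "f = (\<lambda>p. (nm p, fst p mod nm p, snd p mod nm p))"
  define C where "C = \<lceil>1 + 2 * s\<rceil>"
  have nm: "of_int (nm p) = r p * \<sigma> (r p)" for p
  proof (cases p)
    case (Pair a b)
    have "\<sigma> (r p) = of_int a - of_int b * s"
      unfolding Pair r_def by (simp add: conj_eq)
    thus ?thesis
      unfolding Pair nm_def r_def
      by (simp add: sqrt_mult_conj power2_eq_square)
  qed
  have "{x \<in> Zs. 0 < x \<and> \<bar>x * \<sigma> x\<bar> \<le> 1 + 2 * s} \<subseteq> r ` P"
    unfolding Zs_def P_def r_def by (auto simp: image_iff)
  hence inf: "infinite P"
    using infinite_bounded_norm finite_surj by blast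
  have nm_nz: "nm p \<noteq> 0" if "p \<in> P" for p
  proof
    assume "nm p = 0"
    hence "r p * \<sigma> (r p) = 0"
      using nm[of p] by simp
    moreover have "r p \<in> Zs"
      unfolding r_def using Zs_I by (auto split: prod.splits)
    ultimately show False
      using that conj_eq_0_iff Zs_K by (auto simp: P_def)
  qed
  have nm_le: "\<bar>nm p\<bar> \<le> C" if "p \<in> P" for p
  proof -
    have "\<bar>real_of_int (nm p)\<bar> \<le> 1 + 2 * s"
      unfolding nm using that by (simp add: P_def)
    thus ?thesis
      unfolding C_def by linarith
  qed
  have mod_le: "\<bar>a mod n\<bar> \<le> \<bar>n\<bar>" if "n \<noteq> 0" for a n :: int
    using abs_mod_less[OF that, of a] by linarith
  have "f ` P \<subseteq> {-C..C} \<times> {-C..C} \<times> {-C..C}"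
  proof clarify
    fix a b x y z assume ab: "(a, b) \<in> P" "(x, y, z) = f (a, b)"
    have "\<bar>x\<bar> \<le> C" "\<bar>y\<bar> \<le> C" "\<bar>z\<bar> \<le> C"
      using ab(2) nm_le[OF ab(1)] mod_le[OF nm_nz[OF ab(1)], of a] mod_le[OF nm_nz[OF ab(1)], of b]
      by (auto simp: f_def)
    thus "x \<in> {-C..C} \<and> (y, z) \<in> {-C..C} \<times> {-C..C}"
      by auto
  qed
  hence "finite (f ` P)"
    by (rule finite_subset) auto
  hence "\<not> inj_on f P"
    using inf finite_imageD by blast
  then obtain p q where pq: "p \<in> P" "q \<in> P" "f p = f q" "p \<noteq> q"
    unfolding inj_on_def by blast
  obtain a b c d where p: "p = (a, b)" and q: "q = (c, d)"
    by (metis surj_pair)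
  define n where "n = nm p"
  have n: "n = a\<^sup>2 - int D * b\<^sup>2" "n = c\<^sup>2 - int D * d\<^sup>2" "n \<noteq> 0" "n dvd a - c" "n dvd b - d"
    using pq nm_nz[OF pq(1)] by (auto simp: f_def p q nm_def n_def mod_eq_dvd_iff)
  have n': "n dvd c - a" "n dvd d - b"
    using n by (simp_all add: dvd_diff_commute)
  define x y where "x = r p" and "y = r q"
  have xy: "x = of_int a + of_int b * s" "y = of_int c + of_int d * s"
    by (simp_all add: x_def y_def r_def p q)
  have pos: "x > 0" "y > 0"
    using pq by (simp_all add: P_def x_def y_def)
  have "x \<noteq> y"
  proof
    assume eq: "x = y"
    have "b = d"
    proof (rule ccontr)
      assume "b \<noteq> d"
      hence "s = (of_int c - of_int a) / (of_int b - of_int d)"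
        using eq by (simp add: xy field_simps)
      thus False
        using s_irrational by (metis Rats_diff Rats_divide Rats_of_int)
    qed
    thus False
      using eq pq(4) by (simp add: xy p q)
  qed
  have Zs: "x / y \<in> Zs" "y / x \<in> Zs"
    using quotient_in_Zs[OF xy n] quotient_in_Zs[OF xy(2,1) n(2,1,3) n'] by auto
  have "x / y \<in> ring_units D" "y / x \<in> ring_units D"
    using Zs_units[OF Zs] Zs_units[OF Zs(2,1)] pos by simp_all
  moreover have "x / y > 1 \<or> y / x > 1"
    using pos \<open>x \<noteq> y\<close> by (auto simp: field_simps)
  ultimately show ?thesis
    using that by blast
qed

section \<open>The unit group and the fundamental unit\<close>

lemma units_OK: "u \<in> ring_units D \<Longrightarrow> u \<in> \<O>"
  by (simp add: ring_units_def)

lemma units_nz: "u \<in> ring_units D \<Longrightarrow> u \<noteq> 0"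
  by (auto simp: ring_units_def)

lemma units_mult: "u \<in> ring_units D \<Longrightarrow> v \<in> ring_units D \<Longrightarrow> u * v \<in> ring_units D"
proof -
  assume "u \<in> ring_units D" "v \<in> ring_units D"
  then obtain u' v' where "u \<in> \<O>" "u' \<in> \<O>" "u * u' = 1" "v \<in> \<O>" "v' \<in> \<O>" "v * v' = 1"
    unfolding ring_units_def by blast
  moreover from this have "(u * v) * (u' * v') = 1"
    by (metis mult.commute mult.left_commute mult_1)
  ultimately show ?thesis
    unfolding ring_units_def using OK_mult by blast
qed

lemma units_inverse: "u \<in> ring_units D \<Longrightarrow> inverse u \<in> ring_units D"
proof -
  assume "u \<in> ring_units D"
  then obtain v where v: "u \<in> \<O>" "v \<in> \<O>" "u * v = 1"
    unfolding ring_units_def by blast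
  hence "inverse u = v"
    by (intro inverse_unique)
  thus ?thesis
    using v unfolding ring_units_def by (auto simp: mult.commute)
qed

lemma units_minus: "u \<in> ring_units D \<Longrightarrow> - u \<in> ring_units D"
  unfolding ring_units_def using OK_minus by (auto intro!: bexI[of _ "- _"])

lemma units_powi: "u \<in> ring_units D \<Longrightarrow> u powi n \<in> ring_units D"
proof -
  assume u: "u \<in> ring_units D"
  have 1: "1 \<in> ring_units D"
    using OK_of_int[of 1] unfolding ring_units_def by auto
  have "u ^ k \<in> ring_units D" for k
    using u by (induction k) (auto simp: 1 units_mult)
  thus ?thesis
    unfolding power_int_def using units_inverse by (auto simp: power_inverse)
qed

text \<open>A unit and its inverse have norms of absolute value at least 1, and these multiply to
  1.\<close>

lemma units_norm:
  assumes "u \<in> ring_units D"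
  shows "u * \<sigma> u = 1 \<or> u * \<sigma> u = -1"
proof -
  obtain v where v: "u \<in> \<O>" "v \<in> \<O>" "u * v = 1"
    using assms unfolding ring_units_def by blast
  have "\<sigma> u * \<sigma> v = 1"
    using v conj_mult[of u v] conj_rat[of 1] OK_K by simp
  have "(\<bar>u\<bar> * \<bar>\<sigma> u\<bar>) * (\<bar>v\<bar> * \<bar>\<sigma> v\<bar>) = \<bar>(u * v) * (\<sigma> u * \<sigma> v)\<bar>"
    by (simp only: abs_mult ac_simps)
  also have "\<dots> = 1"
    using v \<open>\<sigma> u * \<sigma> v = 1\<close> by simp
  finally have prod: "(\<bar>u\<bar> * \<bar>\<sigma> u\<bar>) * (\<bar>v\<bar> * \<bar>\<sigma> v\<bar>) = 1" .
  have "u \<noteq> 0" "v \<noteq> 0"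
    using v by auto
  hence ge: "\<bar>u\<bar> * \<bar>\<sigma> u\<bar> \<ge> 1" "\<bar>v\<bar> * \<bar>\<sigma> v\<bar> \<ge> 1"
    using norm_ge_1 v by auto
  have "(\<bar>u\<bar> * \<bar>\<sigma> u\<bar>) * 1 \<le> (\<bar>u\<bar> * \<bar>\<sigma> u\<bar>) * (\<bar>v\<bar> * \<bar>\<sigma> v\<bar>)"
    using ge by (intro mult_left_mono) auto
  hence "\<bar>u * \<sigma> u\<bar> = 1"
    using ge prod by (simp add: abs_mult)
  thus ?thesis
    by linarith
qed

text \<open>A smallest unit above 1 exists because units in \<open>(1, u0]\<close> have conjugates
  of absolute value at most 1 and so lie in a finite box. Dividing a positive unit by the right
  power of \<open>e\<close> leaves a unit in \<open>[1, e)\<close>, which minimality makes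
  1.\<close>

lemma fundamental_unit_exists: obtains e where "is_fundamental_unit D e"
proof -
  obtain u0 where u0: "u0 \<in> ring_units D" "u0 > 1"
    using exists_unit_gt_1 .
  define U where "U = {u \<in> ring_units D. 1 < u \<and> u \<le> u0}"
  have "U \<subseteq> {x \<in> \<O>. \<bar>x\<bar> \<le> u0 \<and> \<bar>\<sigma> x\<bar> \<le> 1}"
  proof
    fix u assume "u \<in> U"
    hence u: "u \<in> ring_units D" "1 < u" "u \<le> u0"
      by (auto simp: U_def)
    have "\<bar>u\<bar> * \<bar>\<sigma> u\<bar> = 1"
      using units_norm[OF u(1)] by (metis abs_minus_cancel abs_mult abs_one)
    moreover have "1 * \<bar>\<sigma> u\<bar> \<le> \<bar>u\<bar> * \<bar>\<sigma> u\<bar>"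
      using u by (intro mult_right_mono) auto
    ultimately show "u \<in> {x \<in> \<O>. \<bar>x\<bar> \<le> u0 \<and> \<bar>\<sigma> x\<bar> \<le> 1}"
      using u units_OK by auto
  qed
  hence fin: "finite U"
    using finite_box by (rule finite_subset)
  define e where "e = Min U"
  have "U \<noteq> {}"
    using u0 by (auto simp: U_def)
  hence "e \<in> U"
    unfolding e_def using fin by simp
  hence e: "e \<in> ring_units D" "1 < e" "e \<le> u0"
    by (auto simp: U_def)
  have pos: "\<exists>n::int. u = e powi n" if u: "u \<in> ring_units D" "u > 0" for u
  proof -
    obtain n :: int where n: "e powi n \<le> u" "u < e powi (n + 1)"
      using powi_bracket[OF e(2) u(2)] .
    define w where "w = u * e powi (- n)"
    have ep: "e powi n > 0"
      using e by simp
    have "e powi (n + 1) = e * e powi n"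
      using e by (simp add: power_int_add)
    hence w: "1 \<le> w" "w < e"
      using n ep by (auto simp: w_def power_int_minus field_simps)
    have "w = 1"
    proof (rule ccontr)
      assume "w \<noteq> 1"
      moreover have "w \<in> ring_units D"
        unfolding w_def using u e by (intro units_mult units_powi)
      ultimately have "w \<in> U"
        using w e by (auto simp: U_def)
      hence "e \<le> w"
        unfolding e_def using fin by simp
      thus False
        using w by simp
    qed
    hence "u = e powi n"
      using ep by (simp add: w_def power_int_minus field_simps)
    thus ?thesis ..
  qed
  have "is_fundamental_unit D e"
    unfolding is_fundamental_unit_def
  proof (intro conjI ballI)
    fix u assume u: "u \<in> ring_units D"
    show "\<exists>n::int. u = e powi n \<or> u = - (e powi n)"
    proof (cases "u > 0")
      case False
      hence "- u > 0"
        using units_nz[OF u] by linarith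
      then obtain n :: int where "- u = e powi n"
        using pos[OF units_minus[OF u]] by blast
      hence "u = - (e powi n)"
        by linarith
      thus ?thesis
        by blast
    qed (use pos u in blast)
  qed (use e in auto)
  thus ?thesis
    using that by blast
qed

lemma regulator_eq: "is_fundamental_unit D e \<Longrightarrow> regulator D = ln e"
  unfolding regulator_def using fundamental_unit_unique by (subst the_equality[where a = e]) auto

end

section \<open>Minima and critical twists\<close>

text \<open>Removing the largest and the second largest element gives the recursion of the Fibonacci
  numbers, and \<open>c\<^sup>2 \<le> c + 1\<close> says that powers of \<open>c\<close> grow no
  faster. The factor \<open>c\<^sup>2\<close> on the right covers the starting cases of one and two
  elements.\<close>

lemma fibonacci_growth:
  fixes V :: "real set" and c m :: real
  assumes "finite V" "V \<noteq> {}" and c: "1 \<le> c" "c\<^sup>2 \<le> c + 1" and m: "0 \<le> m" "\<And>x. x \<in> V \<Longrightarrow> m \<le> x"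
    and fib: "\<And>x y z. x \<in> V \<Longrightarrow> y \<in> V \<Longrightarrow> z \<in> V \<Longrightarrow> z < y \<Longrightarrow> y < x \<Longrightarrow> y + z \<le> x"
  shows "c ^ card V * m \<le> c\<^sup>2 * Max V"
  using assms(1,2) m(2) fib
proof (induction V rule: finite_psubset_induct)
  case (psubset V)
  define x where "x = Max V"
  have x: "x \<in> V" "\<And>t. t \<in> V \<Longrightarrow> t \<le> x"
    unfolding x_def using psubset.hyps psubset.prems by auto
  have cc: "c \<le> c\<^sup>2"
    using c by (simp add: power2_eq_square)
  have mx: "m \<le> x" "0 \<le> x"
    using psubset.prems(2)[OF x(1)] m(1) by auto
  show ?case
  proof (cases "V - {x} = {}")
    case True
    hence "V = {x}"
      using x by auto
    hence "card V = 1"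
      by simp
    moreover have "c * m \<le> c\<^sup>2 * x"
      using cc mx m c by (intro mult_mono) auto
    ultimately show ?thesis
      by (simp flip: x_def)
  next
    case V1: False
    define V1 where "V1 = V - {x}"
    define y where "y = Max V1"
    have fin1: "finite V1" "V1 \<noteq> {}" "V1 \<subset> V"
      using psubset.hyps V1 x by (auto simp: V1_def)
    have y: "y \<in> V1" "\<And>t. t \<in> V1 \<Longrightarrow> t \<le> y"
      unfolding y_def using fin1 by auto
    have card1: "card V = Suc (card V1)"
      unfolding V1_def using psubset.hyps x by (metis card_Suc_Diff1)
    have "y < x"
      using y(1) x(2) by (force simp: V1_def)
    show ?thesis
    proof (cases "V1 - {y} = {}")
      case True
      hence "V1 = {y}"
        using y by auto
      hence "card V = 2"
        using card1 by simp
      moreover have "c\<^sup>2 * m \<le> c\<^sup>2 * x"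
        using mx by (intro mult_left_mono) auto
      ultimately show ?thesis
        by (simp flip: x_def)
    next
      case V2: False
      define V2 where "V2 = V1 - {y}"
      define z where "z = Max V2"
      have fin2: "finite V2" "V2 \<noteq> {}" "V2 \<subset> V"
        using fin1 V2 y by (auto simp: V2_def)
      have z: "z \<in> V2"
        unfolding z_def using fin2 by auto
      have card2: "card V1 = Suc (card V2)"
        unfolding V2_def using fin1 y by (metis card_Suc_Diff1)
      have "z < y"
        using z y(2) by (force simp: V2_def)
      have "c ^ card V1 * m \<le> c\<^sup>2 * y"
        unfolding y_def by (rule psubset.IH) (use fin1 psubset.prems in \<open>blast+\<close>)
      moreover have "c ^ card V2 * m \<le> c\<^sup>2 * z"
        unfolding z_def by (rule psubset.IH) (use fin2 psubset.prems in \<open>blast+\<close>)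
      moreover have "c\<^sup>2 * (y + z) \<le> c\<^sup>2 * x"
        using \<open>z < y\<close> \<open>y < x\<close> x(1) y(1) z fin1 fin2
        by (intro mult_left_mono psubset.prems(3)) auto
      moreover have "c ^ card V * m = c\<^sup>2 * (c ^ card V2 * m)"
        by (simp add: card1 card2 power2_eq_square mult_ac)
      moreover have "c\<^sup>2 * (c ^ card V2 * m) \<le> (c + 1) * (c ^ card V2 * m)"
        using c m by (intro mult_right_mono) auto
      moreover have "(c + 1) * (c ^ card V2 * m) = c ^ card V1 * m + c ^ card V2 * m"
        by (simp add: card2 algebra_simps)
      ultimately show ?thesis
        unfolding x_def[symmetric] distrib_left by linarith
    qed
  qed
qed

section \<open>Voronoi minima and shortest elements\<close>

context real_quadratic
begin

text \<open>Minima are normalised to be positive. Among them the order of the elements is opposite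
  to that of the absolute values of their conjugates.\<close>

definition box_minimal :: "real \<Rightarrow> bool" where
  "box_minimal x \<longleftrightarrow> x \<in> \<O> \<and> 0 < x \<and> (\<forall>y\<in>\<O>. y \<noteq> 0 \<longrightarrow> \<bar>y\<bar> < x \<longrightarrow> \<bar>\<sigma> x\<bar> < \<bar>\<sigma> y\<bar>)"

lemma OK_conj_minus: "x \<in> \<O> \<Longrightarrow> \<sigma> (- x) = - \<sigma> x"
  and OK_conj_diff: "x \<in> \<O> \<Longrightarrow> y \<in> \<O> \<Longrightarrow> \<sigma> (x - y) = \<sigma> x - \<sigma> y"
  and OK_conj_mult: "x \<in> \<O> \<Longrightarrow> y \<in> \<O> \<Longrightarrow> \<sigma> (x * y) = \<sigma> x * \<sigma> y"
  and OK_conj_eq_0: "x \<in> \<O> \<Longrightarrow> \<sigma> x = 0 \<longleftrightarrow> x = 0"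
  and OK_conj_conj: "x \<in> \<O> \<Longrightarrow> \<sigma> (\<sigma> x) = x"
  by (simp_all add: OK_K conj_minus conj_diff conj_mult conj_eq_0_iff conj_conj)

lemma OK_abs: "x \<in> \<O> \<Longrightarrow> \<bar>x\<bar> \<in> \<O>" and OK_conj_abs: "x \<in> \<O> \<Longrightarrow> \<bar>\<sigma> \<bar>x\<bar>\<bar> = \<bar>\<sigma> x\<bar>"
  by (auto simp: abs_if OK_minus OK_conj_minus)

text \<open>
  Replacing \<open>z\<close> by a vector \<open>w\<close> next below \<open>y\<close> makes the box \<open>\<bar>t\<bar> < y\<close>, \<open>\<bar>\<sigma> t\<bar> < \<bar>\<sigma> w\<bar>\<close>
  empty; the differences \<open>x - y\<close>, \<open>x - w\<close> and \<open>y - w\<close> cannot all avoid it.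
\<close>

lemma box_minimal_gap:
  assumes x: "box_minimal x" and y: "box_minimal y" and z: "box_minimal z"
    and less: "z < y" "y < x"
  shows "y + z \<le> x"
proof -
  \<comment> \<open>Bounding the conjugate by that of \<open>z\<close> makes the set of candidates
    for \<open>w\<close> finite.\<close>
  define B where "B = {t \<in> \<O>. \<bar>t\<bar> \<le> y \<and> \<bar>\<sigma> t\<bar> \<le> \<bar>\<sigma> z\<bar>} \<inter> {t. t \<noteq> 0 \<and> \<bar>t\<bar> < y}"
  have "finite B"
    unfolding B_def using finite_box by (rule finite_subset[rotated]) auto
  moreover have "z \<in> B"
    using z less by (auto simp: B_def box_minimal_def)
  ultimately obtain w0 where w0: "w0 \<in> B" "\<And>t. t \<in> B \<Longrightarrow> \<bar>\<sigma> w0\<bar> \<le> \<bar>\<sigma> t\<bar>"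
    using ex_min_if_finite[of "(\<lambda>t. \<bar>\<sigma> t\<bar>) ` B"] by (metis (no_types, lifting) Min_in Min_le empty_iff finite_imageI image_iff image_is_empty)
  define w where "w = \<bar>w0\<bar>"
  have w: "w \<in> \<O>" "0 < w" "w < y" "\<bar>\<sigma> w\<bar> \<le> \<bar>\<sigma> z\<bar>"
    using w0(1) by (auto simp: B_def w_def OK_abs OK_conj_abs)
  have empty: "\<bar>\<sigma> w\<bar> \<le> \<bar>\<sigma> t\<bar>" if "t \<in> \<O>" "t \<noteq> 0" "\<bar>t\<bar> < y" for t
  proof (cases "t \<in> B")
    case True
    thus ?thesis
      using w0 by (auto simp: w_def OK_conj_abs B_def)
  next
    case False
    thus ?thesis
      using that w(4) by (auto simp: B_def)
  qed
  have "z \<le> w"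
    using w z unfolding box_minimal_def by force
  have yw: "\<bar>\<sigma> y\<bar> < \<bar>\<sigma> w\<bar>"
    using y w by (auto simp: box_minimal_def)
  have xy: "\<bar>\<sigma> x\<bar> < \<bar>\<sigma> y\<bar>"
    using x y less by (auto simp: box_minimal_def)
  have nz: "\<sigma> x \<noteq> 0"
    using x by (auto simp: box_minimal_def OK_conj_eq_0)
  have O: "x \<in> \<O>" "y \<in> \<O>"
    using x y by (auto simp: box_minimal_def)
  have "y + w \<le> x"
  proof (rule ccontr)
    assume neg: "\<not> y + w \<le> x"
    \<comment> \<open>Each difference is nonzero and of absolute value below \<open>y\<close>, so
      \<open>empty\<close> applies. As \<open>\<sigma> x\<close> and \<open>\<sigma> y\<close> are
      smaller in absolute value than \<open>\<sigma> w\<close>, facts 2 and 3 place both on the side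
      of 0 opposite to \<open>\<sigma> w\<close>, while 1 needs them on different sides.\<close>
    have 1: "\<bar>\<sigma> w\<bar> \<le> \<bar>\<sigma> x - \<sigma> y\<bar>"
      using empty[of "x - y"] O w less neg by (auto simp: OK_diff OK_conj_diff)
    have 2: "\<bar>\<sigma> w\<bar> \<le> \<bar>\<sigma> x - \<sigma> w\<bar>"
      using empty[of "x - w"] O w less neg by (auto simp: OK_diff OK_conj_diff)
    have 3: "\<bar>\<sigma> w\<bar> \<le> \<bar>\<sigma> y - \<sigma> w\<bar>"
      using empty[of "y - w"] O w less by (auto simp: OK_diff OK_conj_diff)
    show False
      using 1 2 3 yw xy nz by linarith
  qed
  thus ?thesis
    using \<open>z \<le> w\<close> by linarith
qed

text \<open>The squared length of the lattice vector \<open>(x, \<sigma> x)\<close> after the twist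
  by \<alpha>.\<close>

definition q :: "real \<Rightarrow> real \<Rightarrow> real" where
  "q \<alpha> x = (\<alpha> * x)\<^sup>2 + (\<sigma> x / \<alpha>)\<^sup>2"

definition shortest :: "real \<Rightarrow> real \<Rightarrow> bool" where
  "shortest \<alpha> v \<longleftrightarrow> v \<in> \<O> \<and> 0 < v \<and> (\<forall>y\<in>\<O>. y \<noteq> 0 \<longrightarrow> q \<alpha> v \<le> q \<alpha> y)"

text \<open>The trace that well-roundedness leaves on \<open>\<O>\<close>: two minimal vectors that
  differ even up to sign.\<close>

definition critical :: "real \<Rightarrow> bool" where
  "critical \<alpha> \<longleftrightarrow> 0 < \<alpha> \<and> (\<exists>v u. shortest \<alpha> v \<and> shortest \<alpha> u \<and> v < u)"

lemma shortest_I: "x \<in> \<O> \<Longrightarrow> x \<noteq> 0 \<Longrightarrow> (\<And>y. y \<in> \<O> \<Longrightarrow> y \<noteq> 0 \<Longrightarrow> q \<alpha> x \<le> q \<alpha> y) \<Longrightarrow> shortest \<alpha> \<bar>x\<bar>"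
proof -
  assume *: "x \<in> \<O>" "x \<noteq> 0" "\<And>y. y \<in> \<O> \<Longrightarrow> y \<noteq> 0 \<Longrightarrow> q \<alpha> x \<le> q \<alpha> y"
  have "(\<sigma> \<bar>x\<bar>)\<^sup>2 = (\<sigma> x)\<^sup>2"
    using OK_conj_abs[OF *(1)] by (metis power2_abs)
  hence "q \<alpha> \<bar>x\<bar> = q \<alpha> x"
    by (simp add: q_def power_mult_distrib power_divide)
  thus ?thesis
    using * by (auto simp: shortest_def OK_abs)
qed

lemma critical_I:
  assumes "0 < \<alpha>" "shortest \<alpha> v" "shortest \<alpha> u" "v \<noteq> u"
  shows "critical \<alpha>"
  using assms unfolding critical_def by (metis linorder_neqE_linordered_idom)

text \<open>A nonzero element with smaller absolute value and no larger conjugate would give a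
  shorter vector.\<close>

lemma shortest_box_minimal:
  assumes "0 < \<alpha>" "shortest \<alpha> v"
  shows "box_minimal v"
  unfolding box_minimal_def
proof (intro conjI ballI impI)
  fix y assume y: "y \<in> \<O>" "y \<noteq> 0" "\<bar>y\<bar> < v"
  have "(\<alpha> * y)\<^sup>2 < (\<alpha> * v)\<^sup>2"
    using y assms by (auto simp: power_mult_distrib shortest_def abs_less_iff intro!: power2_strict_mono mult_strict_left_mono)
  moreover have "q \<alpha> v \<le> q \<alpha> y"
    using y assms by (auto simp: shortest_def)
  ultimately have "(\<sigma> v / \<alpha>)\<^sup>2 < (\<sigma> y / \<alpha>)\<^sup>2"
    by (simp add: q_def)
  hence "\<bar>\<sigma> v / \<alpha>\<bar> < \<bar>\<sigma> y / \<alpha>\<bar>"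
    by (meson abs_le_square_iff not_le)
  thus "\<bar>\<sigma> v\<bar> < \<bar>\<sigma> y\<bar>"
    using assms(1) by (simp add: divide_less_cancel)
qed (use assms in \<open>auto simp: shortest_def\<close>)

text \<open>Multiplied by \<open>\<alpha>\<^sup>2\<close>, squared lengths are affine in the fourth
  power of \<alpha>, so comparing two elements is a linear inequality. Both monotonicity lemmas
  below rest on this.\<close>

lemma q_le_iff:
  assumes "0 < \<alpha>"
  shows "q \<alpha> x \<le> q \<alpha> y \<longleftrightarrow> (\<alpha>\<^sup>2)\<^sup>2 * (x\<^sup>2 - y\<^sup>2) \<le> (\<sigma> y)\<^sup>2 - (\<sigma> x)\<^sup>2"
proof -
  have eq: "\<alpha>\<^sup>2 * q \<alpha> t = (\<alpha>\<^sup>2)\<^sup>2 * t\<^sup>2 + (\<sigma> t)\<^sup>2" for t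
    using assms by (simp add: q_def power_mult_distrib power_divide distrib_left power2_eq_square)
  have "q \<alpha> x \<le> q \<alpha> y \<longleftrightarrow> \<alpha>\<^sup>2 * q \<alpha> x \<le> \<alpha>\<^sup>2 * q \<alpha> y"
    using assms by simp
  thus ?thesis
    unfolding eq right_diff_distrib by linarith
qed

text \<open>If \<open>w\<close> exceeded \<open>v\<close>, the two minimality conditions would bound
  the same difference of squared conjugates from above by \<open>(\<alpha>\<^sup>2)\<^sup>2\<close>
  and from below by \<open>(\<beta>\<^sup>2)\<^sup>2\<close> times
  \<open>w\<^sup>2 - v\<^sup>2\<close>.\<close>

lemma shortest_antimono:
  assumes "0 < \<alpha>" "\<alpha> < \<beta>" "shortest \<alpha> v" "shortest \<beta> w"
  shows "w \<le> v"
proof (rule ccontr)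
  assume "\<not> w \<le> v"
  have pos: "0 < v" "0 < w"
    using assms by (auto simp: shortest_def)
  hence sq: "0 < w\<^sup>2 - v\<^sup>2"
    using \<open>\<not> w \<le> v\<close> by (simp add: power_strict_mono)
  have "q \<alpha> v \<le> q \<alpha> w" "q \<beta> w \<le> q \<beta> v"
    using assms by (auto simp: shortest_def)
  hence "(\<alpha>\<^sup>2)\<^sup>2 * (v\<^sup>2 - w\<^sup>2) \<le> (\<sigma> w)\<^sup>2 - (\<sigma> v)\<^sup>2" "(\<beta>\<^sup>2)\<^sup>2 * (w\<^sup>2 - v\<^sup>2) \<le> (\<sigma> v)\<^sup>2 - (\<sigma> w)\<^sup>2"
    using assms(1,2) q_le_iff by auto
  moreover have "(\<alpha>\<^sup>2)\<^sup>2 * (v\<^sup>2 - w\<^sup>2) = - ((\<alpha>\<^sup>2)\<^sup>2 * (w\<^sup>2 - v\<^sup>2))"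
    by (simp add: algebra_simps)
  moreover have "(\<alpha>\<^sup>2)\<^sup>2 * (w\<^sup>2 - v\<^sup>2) < (\<beta>\<^sup>2)\<^sup>2 * (w\<^sup>2 - v\<^sup>2)"
    using assms(1,2) sq by (intro mult_strict_right_mono power_strict_mono) auto
  ultimately show False
    by linarith
qed

text \<open>The other shortest element \<open>u\<close> at \<beta> gives strictness: if
  \<open>w = v\<close>, then \<open>u\<close> and \<open>v\<close> tie at \<beta>, and at the
  smaller \<alpha> the element \<open>u\<close> with its larger first coordinate would be strictly
  shorter.\<close>

lemma shortest_strict_antimono:
  assumes "0 < \<alpha>" "\<alpha> < \<beta>" "shortest \<alpha> v" "shortest \<beta> w" "shortest \<beta> u" "w < u"
  shows "w < v"
proof -
  have "w \<noteq> v"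
  proof
    assume [simp]: "w = v"
    have "q \<alpha> v \<le> q \<alpha> u" "q \<beta> u \<le> q \<beta> v"
      using assms by (auto simp: shortest_def)
    hence "(\<alpha>\<^sup>2)\<^sup>2 * (v\<^sup>2 - u\<^sup>2) \<le> (\<sigma> u)\<^sup>2 - (\<sigma> v)\<^sup>2" "(\<beta>\<^sup>2)\<^sup>2 * (u\<^sup>2 - v\<^sup>2) \<le> (\<sigma> v)\<^sup>2 - (\<sigma> u)\<^sup>2"
      using assms(1,2) q_le_iff by auto
    moreover have "(\<alpha>\<^sup>2)\<^sup>2 * (v\<^sup>2 - u\<^sup>2) = - ((\<alpha>\<^sup>2)\<^sup>2 * (u\<^sup>2 - v\<^sup>2))"
      by (simp add: algebra_simps)
    moreover have "0 < u\<^sup>2 - v\<^sup>2"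
      using assms by (simp add: power_strict_mono shortest_def)
    hence "(\<alpha>\<^sup>2)\<^sup>2 * (u\<^sup>2 - v\<^sup>2) < (\<beta>\<^sup>2)\<^sup>2 * (u\<^sup>2 - v\<^sup>2)"
      using assms(1,2) by (intro mult_strict_right_mono power_strict_mono) auto
    ultimately show False
      by linarith
  qed
  thus ?thesis
    using shortest_antimono[OF assms(1-4)] by simp
qed

section \<open>Units and conjugation acting on twists\<close>

lemma units_norm_sq: "u \<in> ring_units D \<Longrightarrow> (\<sigma> u)\<^sup>2 = 1 / u\<^sup>2"
proof -
  assume u: "u \<in> ring_units D"
  have "(u * \<sigma> u)\<^sup>2 = 1"
    using units_norm[OF u] by auto
  thus ?thesis
    using units_nz[OF u] by (simp add: power_mult_distrib field_simps)
qed

lemma OK_unit_divide: "u \<in> ring_units D \<Longrightarrow> x \<in> \<O> \<Longrightarrow> x / u \<in> \<O>"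
  using OK_mult[OF _ units_OK[OF units_inverse]] by (simp add: divide_inverse)

text \<open>Lengths involve only squares of conjugates, so units of either norm are allowed here,
  whereas equality of lattices in \<open>twisted_norm_1\<close> is about norm 1.\<close>

lemma q_unit:
  assumes "u \<in> ring_units D" "x \<in> \<O>"
  shows "q (u * \<alpha>) x = q \<alpha> (u * x)"
  using assms units_norm_sq[OF assms(1)]
  by (simp add: q_def OK_conj_mult units_OK power_mult_distrib power_divide field_simps)

lemma shortest_unit:
  assumes u: "u \<in> ring_units D" "0 < u" and v: "shortest \<alpha> v"
  shows "shortest (u * \<alpha>) (v / u)"
  unfolding shortest_def
proof (intro conjI ballI impI)
  have "v \<in> \<O>" "0 < v"
    using v by (auto simp: shortest_def)
  thus vu: "v / u \<in> \<O>" "0 < v / u"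
    using u OK_unit_divide by auto
  fix y assume y: "y \<in> \<O>" "y \<noteq> 0"
  have "q \<alpha> v \<le> q \<alpha> (u * y)"
    using v y u by (auto simp: shortest_def OK_mult units_OK)
  thus "q (u * \<alpha>) (v / u) \<le> q (u * \<alpha>) y"
    using u y vu by (simp add: q_unit)
qed

lemma critical_unit:
  assumes u: "u \<in> ring_units D" "0 < u" and "critical \<alpha>"
  shows "critical (u * \<alpha>)"
proof -
  obtain v w where "0 < \<alpha>" "shortest \<alpha> v" "shortest \<alpha> w" "v < w"
    using assms(3) unfolding critical_def by blast
  thus ?thesis
    using u by (intro critical_I[of _ "v / u" "w / u"] shortest_unit) auto
qed

text \<open>Conjugation exchanges the two coordinates, and with them \<alpha> and
  \<open>1 / \<alpha>\<close>.\<close>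

lemma q_inverse:
  assumes "x \<in> \<O>"
  shows "q (1 / \<alpha>) (\<sigma> x) = q \<alpha> x"
  using assms by (simp add: q_def OK_conj_conj mult.commute)

lemma shortest_inverse:
  assumes "shortest \<alpha> v"
  shows "shortest (1 / \<alpha>) \<bar>\<sigma> v\<bar>"
proof (rule shortest_I)
  have v: "v \<in> \<O>" "0 < v"
    using assms by (auto simp: shortest_def)
  show "\<sigma> v \<in> \<O>" "\<sigma> v \<noteq> 0"
    using v by (auto simp: OK_conj OK_conj_eq_0)
  fix y assume y: "y \<in> \<O>" "y \<noteq> 0"
  have "q \<alpha> v \<le> q \<alpha> (\<sigma> y)"
    using assms y by (auto simp: shortest_def OK_conj OK_conj_eq_0)
  thus "q (1 / \<alpha>) (\<sigma> v) \<le> q (1 / \<alpha>) y"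
    using q_inverse[OF v(1), of \<alpha>] q_inverse[OF OK_conj[OF y(1)], of \<alpha>] OK_conj_conj[OF y(1)] by simp
qed

lemma critical_inverse:
  assumes "critical \<alpha>"
  shows "critical (1 / \<alpha>)"
proof -
  obtain v w where vw: "0 < \<alpha>" "shortest \<alpha> v" "shortest \<alpha> w" "v < w"
    using assms unfolding critical_def by blast
  hence "box_minimal w" "v \<in> \<O>" "0 < v"
    using shortest_box_minimal by (auto simp: shortest_def)
  \<comment> \<open>The larger minimum has the smaller conjugate, so the two stay distinct after
    conjugation.\<close>
  hence "\<bar>\<sigma> w\<bar> < \<bar>\<sigma> v\<bar>"
    using vw by (auto simp: box_minimal_def)
  thus ?thesis
    using vw by (intro critical_I[of _ "\<bar>\<sigma> v\<bar>" "\<bar>\<sigma> w\<bar>"] shortest_inverse) auto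
qed

text \<open>Sending each critical point to its smaller shortest element is injective by
  \<open>shortest_strict_antimono\<close>. The values are minima within a factor \<open>e\<close> of
  each other, so \<open>fibonacci_growth\<close> bounds their number. The maximum with 1 covers
  empty \<open>S\<close>.\<close>

lemma card_critical_window:
  assumes e: "e \<in> ring_units D" "0 < e" and "0 < \<beta>"
    and S: "finite S" "S \<subseteq> {\<alpha>. critical \<alpha> \<and> \<beta> \<le> \<alpha> \<and> \<alpha> < e * \<beta>}"
    and c: "1 \<le> c" "c\<^sup>2 \<le> c + 1"
  shows "c ^ card S \<le> max 1 (c\<^sup>2 * e)"
proof (cases "S = {}")
  case False
  have "\<forall>\<alpha>\<in>S. \<exists>v. shortest \<alpha> v \<and> (\<exists>u. shortest \<alpha> u \<and> v < u)"
    using S unfolding critical_def by blast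
  then obtain g where g: "\<And>\<alpha>. \<alpha> \<in> S \<Longrightarrow> shortest \<alpha> (g \<alpha>) \<and> (\<exists>u. shortest \<alpha> u \<and> g \<alpha> < u)"
    by metis
  have S': "0 < \<alpha>" "\<beta> \<le> \<alpha>" "\<alpha> < e * \<beta>" if "\<alpha> \<in> S" for \<alpha>
    using that S by (auto simp: critical_def)
  have less: "g \<alpha>' < g \<alpha>" if \<alpha>: "\<alpha> \<in> S" "\<alpha>' \<in> S" "\<alpha> < \<alpha>'" for \<alpha> \<alpha>'
  proof -
    obtain u where "shortest \<alpha>' u" "g \<alpha>' < u"
      using g[OF \<alpha>(2)] by blast
    thus ?thesis
      using shortest_strict_antimono[OF S'(1)[OF \<alpha>(1)] \<alpha>(3)] g[OF \<alpha>(1)] g[OF \<alpha>(2)] by blast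
  qed
  have "inj_on g S"
  proof (rule inj_onI)
    fix \<alpha> \<alpha>' assume "\<alpha> \<in> S" "\<alpha>' \<in> S" "g \<alpha> = g \<alpha>'"
    thus "\<alpha> = \<alpha>'"
      using less[of \<alpha> \<alpha>'] less[of \<alpha>' \<alpha>] by (cases \<alpha> \<alpha>' rule: linorder_cases) auto
  qed
  hence card: "card (g ` S) = card S"
    by (rule card_image)
  define m where "m = Min (g ` S)"
  have m: "m \<in> g ` S" "\<And>x. x \<in> g ` S \<Longrightarrow> m \<le> x"
    unfolding m_def using S False by auto
  have "Max (g ` S) \<in> g ` S"
    using S False by auto
  \<comment> \<open>Multiplication by \<open>e\<close> moves each point of the window above the
    whole window and divides its shortest elements by \<open>e\<close>, so monotonicity compares
    \<open>x / e\<close> with \<open>y\<close>.\<close>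
  moreover have "x / e \<le> y" if xy: "x \<in> g ` S" "y \<in> g ` S" for x y
  proof -
    obtain \<alpha> \<alpha>' where \<alpha>: "\<alpha> \<in> S" "x = g \<alpha>" "\<alpha>' \<in> S" "y = g \<alpha>'"
      using xy by blast
    have "\<alpha>' < e * \<beta>" "e * \<beta> \<le> e * \<alpha>"
      using S' \<alpha> e by auto
    hence "\<alpha>' < e * \<alpha>"
      by linarith
    moreover have "shortest (e * \<alpha>) (x / e)" "shortest \<alpha>' y"
      using shortest_unit[OF e] g \<alpha> by auto
    ultimately show ?thesis
      using shortest_antimono[OF S'(1)[OF \<alpha>(3)]] by blast
  qed
  ultimately have "Max (g ` S) / e \<le> m"
    using m by blast
  hence max: "Max (g ` S) \<le> e * m"
    using e by (simp add: field_simps)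
  have "0 < m"
    using m(1) g by (auto simp: shortest_def)
  have "c ^ card (g ` S) * m \<le> c\<^sup>2 * Max (g ` S)"
  proof (rule fibonacci_growth)
    have bm: "box_minimal x" if "x \<in> g ` S" for x
      using that g S' shortest_box_minimal by blast
    show "\<And>x y z. x \<in> g ` S \<Longrightarrow> y \<in> g ` S \<Longrightarrow> z \<in> g ` S \<Longrightarrow> z < y \<Longrightarrow> y < x \<Longrightarrow> y + z \<le> x"
      using bm box_minimal_gap by blast
  qed (use S False c m \<open>0 < m\<close> in auto)
  also have "\<dots> \<le> c\<^sup>2 * (e * m)"
    using max by (intro mult_left_mono) auto
  finally have "c ^ card S \<le> c\<^sup>2 * e"
    using \<open>0 < m\<close> by (simp add: card)
  thus ?thesis
    by simp
qed simp

end

section \<open>Similarity classes\<close>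

text \<open>The inequality \<open>ln t \<le> t - 1\<close> at \<open>t = 8 / 9\<close> gives
  \<open>1 / 9 \<le> ln (9 / 8)\<close>.\<close>

lemma ln_nine_eighths_power_4: "4 / 9 \<le> ln ((9 / 8) ^ 4 :: real)"
proof -
  have "ln (8 / 9 :: real) \<le> 8 / 9 - 1"
    by (intro ln_le_minus_one) simp
  moreover have "ln (9 / 8 :: real) = - ln (8 / 9)"
    by (simp add: ln_div)
  ultimately show ?thesis
    by (simp add: ln_realpow)
qed

section \<open>Twisted lattices and their similarities\<close>

context real_quadratic
begin

definition twisted :: "real \<Rightarrow> (real^2) set" where
  "twisted \<alpha> = (\<lambda>v. twist \<alpha> *v v) ` quad_lattice D"

definition vec :: "real \<Rightarrow> real \<Rightarrow> real^2" where
  "vec \<alpha> x = vector [\<alpha> * x, \<sigma> x / \<alpha>]"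

lemma twisted_eq: "twisted \<alpha> = vec \<alpha> ` \<O>"
proof -
  have "twist \<alpha> *v vector [x, \<sigma> x] = vec \<alpha> x" for x
    by (simp add: vec_eq_iff forall_2 matrix_vector_mult_def sum_2 twist_def vec_def)
  thus ?thesis
    unfolding twisted_def quad_lattice_def by (auto simp: image_iff) metis
qed

lemma norm_vec: "norm (vec \<alpha> x) \<le> norm (vec \<alpha> y) \<longleftrightarrow> q \<alpha> x \<le> q \<alpha> y"
proof -
  have "norm (vec \<alpha> x) = sqrt (q \<alpha> x)" for x
    by (simp add: norm_vec_def L2_set_def sum_2 vec_def q_def)
  thus ?thesis
    by simp
qed

lemma vec_eq_0: "0 < \<alpha> \<Longrightarrow> x \<in> \<O> \<Longrightarrow> vec \<alpha> x = 0 \<longleftrightarrow> x = 0"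
  by (auto simp: vec_eq_iff forall_2 vec_def OK_conj_eq_0)

lemma vec_minus: "x \<in> \<O> \<Longrightarrow> vec \<alpha> (- x) = - vec \<alpha> x"
  by (simp add: vec_eq_iff forall_2 vec_def OK_conj_minus)

lemma minimal_vectors_twisted:
  assumes "0 < \<alpha>" "w \<in> minimal_vectors (twisted \<alpha>)"
  obtains x where "x \<in> \<O>" "w = vec \<alpha> x" "shortest \<alpha> \<bar>x\<bar>"
proof -
  obtain x where x: "x \<in> \<O>" "w = vec \<alpha> x"
    using assms(2) unfolding minimal_vectors_def twisted_eq by blast
  have "x \<noteq> 0"
    using assms x vec_eq_0 by (auto simp: minimal_vectors_def)
  moreover have "q \<alpha> x \<le> q \<alpha> y" if "y \<in> \<O>" "y \<noteq> 0" for y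
    using assms that x vec_eq_0 by (auto simp: minimal_vectors_def twisted_eq norm_vec)
  ultimately show ?thesis
    using that x shortest_I by blast
qed

text \<open>Minimal vectors that span the plane cannot all lie on one line, and two of them on
  different lines come from elements that differ even up to sign.\<close>

lemma well_rounded_imp_critical:
  assumes "0 < \<alpha>" "well_rounded (twisted \<alpha>)"
  shows "critical \<alpha>"
proof -
  let ?M = "minimal_vectors (twisted \<alpha>)"
  have span: "span ?M = UNIV"
    using assms(2) by (simp add: well_rounded_def)
  have not_sub: "\<not> ?M \<subseteq> span {w}" for w
  proof
    assume "?M \<subseteq> span {w}"
    hence "span {w} = UNIV"
      using span span_minimal[of ?M "span {w}"] by auto
    hence "dim (UNIV :: (real^2) set) \<le> card {w}"
      by (metis dim_le_card finite.emptyI finite.insertI order_refl)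
    thus False
      by simp
  qed
  obtain w where w: "w \<in> ?M"
    using not_sub[of 0] by blast
  obtain w' where w': "w' \<in> ?M" "w' \<notin> span {w}"
    using not_sub[of w] by blast
  obtain x where x: "x \<in> \<O>" "w = vec \<alpha> x" "shortest \<alpha> \<bar>x\<bar>"
    using minimal_vectors_twisted[OF assms(1) w] .
  obtain y where y: "y \<in> \<O>" "w' = vec \<alpha> y" "shortest \<alpha> \<bar>y\<bar>"
    using minimal_vectors_twisted[OF assms(1) w'(1)] .
  have "w \<in> span {w}"
    by (simp add: span_base)
  hence "y \<noteq> x" "y \<noteq> - x"
    using w'(2) x y vec_minus[OF x(1)] span_neg[of w "{w}"] by auto
  hence "\<bar>x\<bar> \<noteq> \<bar>y\<bar>"
    by (auto simp: abs_eq_iff)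
  thus ?thesis
    using assms(1) x(3) y(3) by (rule critical_I[rotated 3])
qed

text \<open>Multiplication by \<open>u\<close> permutes \<open>\<O>\<close> and acts on the plane as
  the diagonal matrix with entries \<open>u\<close> and \<open>1 / u\<close>, so the twist is
  absorbed.\<close>

lemma twisted_norm_1:
  assumes u: "u \<in> ring_units D" "u * \<sigma> u = 1"
  shows "twisted (u * \<alpha>) = twisted \<alpha>"
proof -
  have nz: "u \<noteq> 0"
    using units_nz[OF u(1)] .
  have s: "\<sigma> u = 1 / u"
    using u(2) nz by (simp add: field_simps)
  have "vec (u * \<alpha>) x = vec \<alpha> (u * x)" if "x \<in> \<O>" for x
    using that u by (simp add: vec_def OK_conj_mult units_OK s mult_ac)
  hence "vec (u * \<alpha>) ` \<O> = vec \<alpha> ` ((*) u ` \<O>)"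
    by (auto simp: image_iff)
  also have "(*) u ` \<O> = \<O>"
  proof
    show "\<O> \<subseteq> (*) u ` \<O>"
    proof
      fix x assume "x \<in> \<O>"
      hence "x / u \<in> \<O>" "x = u * (x / u)"
        using OK_unit_divide[OF u(1)] nz by auto
      thus "x \<in> (*) u ` \<O>"
        by blast
    qed
  qed (use u in \<open>auto simp: OK_mult units_OK\<close>)
  finally show ?thesis
    by (simp add: twisted_eq)
qed

text \<open>
  Galois conjugation followed by a unit of norm \<open>-1\<close> acts on the plane as a rotation by a right
  angle, and reverses the direction of the twists.
\<close>

lemma twisted_norm_minus_1:
  assumes u: "u \<in> ring_units D" "u * \<sigma> u = -1"
  shows "similar (twisted \<alpha>) (twisted (u * (1 / \<alpha>)))"
proof -
  define Q :: "real^2^2" where "Q = vector [vector [0, 1], vector [-1, 0]]"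
  have nz: "u \<noteq> 0"
    using units_nz[OF u(1)] .
  have s: "\<sigma> u = - (1 / u)"
    using u(2) nz by (simp add: field_simps)
  have rot: "rotation_matrix Q"
    by (simp add: rotation_matrix_def orthogonal_matrix Q_def det_2 vec_eq_iff forall_2
        matrix_matrix_mult_def transpose_def sum_2 mat_def)
  \<comment> \<open>Conjugation alone is a reflection; the norm \<open>-1\<close> of
    \<open>u\<close> supplies the sign change that makes it a rotation. The minus sign in
    \<open>f\<close> selects \<open>Q\<close> over \<open>- Q\<close>.\<close>
  define f where "f = (\<lambda>x. - \<sigma> (u * x))"
  have f_OK: "f x \<in> \<O>" if "x \<in> \<O>" for x
    unfolding f_def using OK_mult[OF units_OK[OF u(1)] that] by (intro OK_minus OK_conj)
  have vec_f: "vec (u * (1 / \<alpha>)) (f x) = 1 *\<^sub>R (Q *v vec \<alpha> x)" if "x \<in> \<O>" for x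
  proof -
    have ux: "u * x \<in> \<O>"
      using OK_mult[OF units_OK[OF u(1)] that] .
    have "f x = \<sigma> x / u"
      using that u by (simp add: f_def OK_conj_mult units_OK s)
    moreover have "\<sigma> (f x) = - (u * x)"
      unfolding f_def OK_conj_minus[OF OK_conj[OF ux]] OK_conj_conj[OF ux] ..
    ultimately show ?thesis
      using nz by (simp add: vec_def Q_def vec_eq_iff forall_2 matrix_vector_mult_def sum_2)
  qed
  have "f ` \<O> = \<O>"
  proof
    show "\<O> \<subseteq> f ` \<O>"
    proof
      fix x assume x: "x \<in> \<O>"
      have "- \<sigma> x / u \<in> \<O>"
        using x u by (intro OK_unit_divide OK_minus OK_conj)
      moreover have "f (- \<sigma> x / u) = x"
        using x nz by (simp add: f_def OK_conj_minus OK_conj OK_conj_conj)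
      ultimately show "x \<in> f ` \<O>"
        by (metis image_eqI)
    qed
  qed (use f_OK in auto)
  hence "twisted (u * (1 / \<alpha>)) = vec (u * (1 / \<alpha>)) ` (f ` \<O>)"
    by (simp add: twisted_eq)
  also have "\<dots> = (\<lambda>v. 1 *\<^sub>R (Q *v v)) ` twisted \<alpha>"
    unfolding twisted_eq image_image by (rule image_cong[OF refl vec_f])
  finally show ?thesis
    unfolding similar_def using rot zero_less_one by blast
qed

lemma similar_refl: "similar L L"
  using equiv_similar by (auto simp: equiv_def refl_on_def)

text \<open>
  A unit of norm \<open>1\<close> identifies \<open>\<alpha>\<close> with \<open>u\<alpha>\<close>, one of norm \<open>-1\<close> identifies it with \<open>u/\<alpha>\<close>. The choice
  \<open>\<beta> = sqrt e\<close> makes the same window \<open>[\<beta>, e\<beta>]\<close> serve both cases: \<open>\<delta> \<mapsto> e\<^sup>2/\<delta>\<close> preserves it.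
\<close>

lemma critical_representative:
  assumes e: "is_fundamental_unit D e" and \<beta>: "0 < \<beta>" "\<beta>\<^sup>2 = e" and \<alpha>: "critical \<alpha>"
  obtains \<gamma> where "critical \<gamma>" "\<beta> \<le> \<gamma>" "\<gamma> \<le> e * \<beta>" "similar (twisted \<alpha>) (twisted \<gamma>)"
proof -
  have e1: "e > 1" "e \<in> ring_units D"
    using e by (auto simp: is_fundamental_unit_def)
  have pos: "\<alpha> > 0"
    using \<alpha> by (simp add: critical_def)
  obtain n :: int where n: "e powi n \<le> \<alpha> / \<beta>" "\<alpha> / \<beta> < e powi (n + 1)"
    using powi_bracket[OF e1(1), of "\<alpha> / \<beta>"] pos \<beta> by auto
  define w where "w = e powi n"
  have w: "0 < w" "w \<in> ring_units D" "inverse w \<in> ring_units D"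
    unfolding w_def using e1 units_powi units_inverse by auto
  define \<delta> where "\<delta> = inverse w * \<alpha>"
  have \<alpha>_eq: "\<alpha> = w * \<delta>"
    using w by (simp add: \<delta>_def)
  have "e powi (n + 1) = e * w"
    using e1 by (simp add: w_def power_int_add)
  hence \<delta>: "\<beta> \<le> \<delta>" "\<delta> < e * \<beta>"
    using n w \<beta> by (auto simp: \<alpha>_eq field_simps simp flip: w_def)
  have crit: "critical \<delta>"
    unfolding \<delta>_def using w \<alpha> by (intro critical_unit) auto
  show ?thesis
  proof (cases "w * \<sigma> w = 1")
    case True
    hence "twisted \<alpha> = twisted \<delta>"
      unfolding \<alpha>_eq using w by (intro twisted_norm_1)
    thus ?thesis
      using that[OF crit] \<delta> similar_refl by simp
  next
    case False
    \<comment> \<open>Here \<open>w\<close> has norm \<open>-1\<close>, so \<alpha> has to be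
      reflected. The factor \<open>e\<^sup>2\<close> has norm 1 even if \<open>e\<close> has norm
      \<open>-1\<close>, and brings the reflected point to \<open>e\<^sup>2 / \<delta>\<close>, back
      in the window.\<close>
    define u where "u = e\<^sup>2 * w"
    have "e\<^sup>2 * \<sigma> (e\<^sup>2) = (e * \<sigma> e)\<^sup>2"
      using OK_K[OF units_OK[OF e1(2)]] by (simp add: conj_power power_mult_distrib)
    also have "\<dots> = 1"
      using units_norm[OF e1(2)] by auto
    finally have e2: "e\<^sup>2 * \<sigma> (e\<^sup>2) = 1" .
    have e2_unit: "e\<^sup>2 \<in> ring_units D"
      using e1 by (simp add: power2_eq_square units_mult)
    have u: "u \<in> ring_units D" "0 < u"
      unfolding u_def using e2_unit w e1 by (auto intro!: units_mult)
    have "u * \<sigma> u = (e\<^sup>2 * \<sigma> (e\<^sup>2)) * (w * \<sigma> w)"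
      using e2_unit w by (simp add: u_def OK_conj_mult units_OK)
    also have "\<dots> = -1"
      using e2 False units_norm[OF w(2)] by simp
    finally have "u * \<sigma> u = -1" .
    hence sim: "similar (twisted \<alpha>) (twisted (u * (1 / \<alpha>)))"
      using u by (intro twisted_norm_minus_1)
    have crit': "critical (u * (1 / \<alpha>))"
      using u \<alpha> by (intro critical_unit critical_inverse)
    have *: "u * (1 / \<alpha>) = \<beta>\<^sup>2 * \<beta>\<^sup>2 / \<delta>"
      unfolding \<beta>(2) using w by (simp add: u_def \<alpha>_eq power2_eq_square)
    have d0: "0 < \<delta>"
      using \<delta> \<beta> by linarith
    have "\<beta> * \<delta> \<le> \<beta> * (\<beta>\<^sup>2 * \<beta>)" "(\<beta>\<^sup>2 * \<beta>) * \<beta> \<le> (\<beta>\<^sup>2 * \<beta>) * \<delta>"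
      using \<delta> \<beta> by (intro mult_left_mono; simp)+
    hence "\<beta> \<le> \<beta>\<^sup>2 * \<beta>\<^sup>2 / \<delta>" "\<beta>\<^sup>2 * \<beta>\<^sup>2 / \<delta> \<le> \<beta>\<^sup>2 * \<beta>"
      using d0 by (simp_all add: field_simps power2_eq_square)
    thus ?thesis
      using that[OF crit' _ _ sim] unfolding * \<beta>(2) by blast
  qed
qed

text \<open>Taking logarithms in \<open>card_critical_window\<close> gives at most
  \<open>2 + ln e / ln c\<close> points. The golden ratio would give a better constant than
  \<open>4 / sqrt 3\<close>; the chosen \<open>c\<close> has to satisfy
  \<open>sqrt 3 / 4 \<le> ln c\<close>.\<close>

lemma finite_critical_window:
  assumes e: "is_fundamental_unit D e" and "0 < \<beta>"
  defines "S \<equiv> {\<alpha>. critical \<alpha> \<and> \<beta> \<le> \<alpha> \<and> \<alpha> < e * \<beta>}"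
  shows "finite S" "real (card S) \<le> 2 + 4 * ln e / sqrt 3"
proof -
  \<comment> \<open>a rational lower bound for the golden ratio\<close>
  define c :: real where "c = (9 / 8) ^ 4"
  have c: "1 < c" "c\<^sup>2 \<le> c + 1"
    by (simp_all add: c_def power_divide)
  have e1: "e > 1" "e \<in> ring_units D"
    using e by (auto simp: is_fundamental_unit_def)
  have bound: "c ^ card T \<le> c\<^sup>2 * e" if "finite T" "T \<subseteq> S" for T
  proof -
    have "1 * 1 \<le> c\<^sup>2 * e"
      using c e1 by (intro mult_mono) auto
    moreover have "c ^ card T \<le> max 1 (c\<^sup>2 * e)"
      using that e1 c \<open>0 < \<beta>\<close> unfolding S_def by (intro card_critical_window) auto
    ultimately show ?thesis
      by simp
  qed
  show fin: "finite S"
  proof (rule ccontr)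
    assume "infinite S"
    obtain N where "c\<^sup>2 * e < c ^ N"
      using real_arch_pow c by blast
    moreover obtain T where "finite T" "card T = N" "T \<subseteq> S"
      using infinite_arbitrarily_large[OF \<open>infinite S\<close>] by blast
    ultimately show False
      using bound[of T] by simp
  qed
  have lnc: "4 / 9 \<le> ln c"
    unfolding c_def by (rule ln_nine_eighths_power_4)
  have le: "ln (c ^ card S) \<le> ln (c\<^sup>2 * e)"
    using bound[OF fin] c e1 by simp
  have "card S * ln c \<le> 2 * ln c + ln e"
    using le c e1 by (simp add: ln_mult ln_realpow)
  hence *: "(real (card S) - 2) * ln c \<le> ln e"
    by (simp add: algebra_simps)
  \<comment> \<open>Four times the lower bound \<open>4 / 9\<close> for \<open>ln c\<close>.\<close>
  have sqrt3: "sqrt 3 \<le> 16 / 9"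
    by (rule real_le_lsqrt) (simp_all add: power2_eq_square)
  show "real (card S) \<le> 2 + 4 * ln e / sqrt 3"
  proof (cases "card S \<le> 2")
    case True
    moreover have "0 \<le> 4 * ln e / sqrt 3"
      using e1 by simp
    ultimately show ?thesis
      by linarith
  next
    case False
    have "sqrt 3 / 4 \<le> ln c"
      using lnc sqrt3 by linarith
    hence "(real (card S) - 2) * (sqrt 3 / 4) \<le> (real (card S) - 2) * ln c"
      using False by (intro mult_left_mono) auto
    hence "(real (card S) - 2) * (sqrt 3 / 4) \<le> ln e"
      using * by linarith
    thus ?thesis
      by (simp add: field_simps)
  qed
qed

lemma wr_classes_bound:
  "finite (wr_classes D)" "real (card (wr_classes D)) \<le> 4 * regulator D / sqrt 3 + 3"
proof -
  obtain e where e: "is_fundamental_unit D e"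
    using fundamental_unit_exists .
  have e1: "e > 1"
    using e by (simp add: is_fundamental_unit_def)
  define \<beta> where "\<beta> = sqrt e"
  have \<beta>: "0 < \<beta>" "\<beta>\<^sup>2 = e"
    using e1 by (simp_all add: \<beta>_def)
  define S where "S = {\<alpha>. critical \<alpha> \<and> \<beta> \<le> \<alpha> \<and> \<alpha> < e * \<beta>}"
  have S: "finite S" "real (card S) \<le> 2 + 4 * ln e / sqrt 3"
    unfolding S_def using finite_critical_window[OF e \<beta>(1)] by auto
  let ?R = "{(L, M). similar L M}"
  let ?cl = "\<lambda>\<gamma>. ?R `` {twisted \<gamma>}"
  \<comment> \<open>The reflection can send the lower end \<beta> to the upper end
    \<open>e * \<beta>\<close>, which the half-open \<open>S\<close> lacks. Adding this point turns
    the 2 in the bound for \<open>S\<close> into the final 3.\<close>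
  have sub: "wr_classes D \<subseteq> ?cl ` insert (e * \<beta>) S"
  proof
    fix C assume "C \<in> wr_classes D"
    then obtain L where L: "L \<in> wr_twists D" "C = ?R `` {L}"
      unfolding wr_classes_def quotient_def by blast
    then obtain \<alpha> where \<alpha>: "0 < \<alpha>" "L = twisted \<alpha>" "well_rounded L"
      unfolding wr_twists_def twisted_def by blast
    then obtain \<gamma> where \<gamma>: "critical \<gamma>" "\<beta> \<le> \<gamma>" "\<gamma> \<le> e * \<beta>" "similar (twisted \<alpha>) (twisted \<gamma>)"
      using critical_representative[OF e \<beta> well_rounded_imp_critical] by metis
    have "C = ?cl \<gamma>"
      unfolding L(2) \<alpha>(2) using \<gamma>(4) by (intro equiv_class_eq[OF equiv_similar]) simp
    moreover have "\<gamma> \<in> insert (e * \<beta>) S"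
      using \<gamma> by (auto simp: S_def)
    ultimately show "C \<in> ?cl ` insert (e * \<beta>) S"
      by blast
  qed
  show "finite (wr_classes D)"
    using finite_subset[OF sub] S(1) by simp
  have "card (wr_classes D) \<le> card (insert (e * \<beta>) S)"
    using S(1) by (intro surj_card_le[OF _ sub]) simp
  also have "\<dots> \<le> Suc (card S)"
    by (simp add: card_insert_if S(1))
  finally show "real (card (wr_classes D)) \<le> 4 * regulator D / sqrt 3 + 3"
    unfolding regulator_eq[OF e] using S(2) by linarith
qed

end

section \<open>The asymptotic statement\<close>

theorem theorem4p5:
  shows "\<exists>E :: nat \<Rightarrow> real. E \<in> O[quad_fields_by_disc](\<lambda>D. quad_disc D powr (1/4)) \<and>
    (\<forall>\<^sub>F D in quad_fields_by_disc.
       finite (wr_classes D) \<and>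
       real (card (wr_classes D)) \<le> 4 * regulator D / sqrt 3 + E D)"
proof (intro exI conjI)
  \<comment> \<open>The error term is the constant 3. The filter refines the pullback of
    \<open>at_top\<close> along \<open>quad_disc\<close>, so the discriminant is eventually at least
    1 without being computed.\<close>
  have "\<forall>\<^sub>F D in filtercomap quad_disc at_top. 1 \<le> quad_disc D"
    using eventually_ge_at_top by (rule eventually_filtercomapI)
  hence "\<forall>\<^sub>F D in quad_fields_by_disc. 1 \<le> quad_disc D"
    unfolding quad_fields_by_disc_def by (rule filter_leD[OF inf_le1])
  hence "\<forall>\<^sub>F D in quad_fields_by_disc. norm (3::real) \<le> 3 * norm (quad_disc D powr (1/4))"
    by eventually_elim (simp add: ge_one_powr_ge_zero)
  thus "(\<lambda>_. 3) \<in> O[quad_fields_by_disc](\<lambda>D. quad_disc D powr (1/4))"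
    by (rule bigoI)
  have "\<forall>\<^sub>F D in principal {D. D > 1 \<and> squarefree D}. D > 1 \<and> squarefree D"
    by (simp add: eventually_principal)
  hence "\<forall>\<^sub>F D in quad_fields_by_disc. D > 1 \<and> squarefree D"
    unfolding quad_fields_by_disc_def by (rule filter_leD[OF inf_le2])
  thus "\<forall>\<^sub>F D in quad_fields_by_disc.
      finite (wr_classes D) \<and> real (card (wr_classes D)) \<le> 4 * regulator D / sqrt 3 + 3"
  proof eventually_elim
    case (elim D)
    then interpret real_quadratic D
      by unfold_locales auto
    show ?case
      using wr_classes_bound by blast
  qed
qed

end
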